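(* Let $N,\Gamma,K$ be finitely generated groups fitting into a short exact sequence $$1\rightarrow N\rightarrow \Gamma \rightarrow K\rightarrow 1.$$ If $N$ has computable F\o lner sets, the distortion function $\Delta_N^{\Gamma}$ is subrecursive, and $K$ is amenable with solvable Word Problem, then $\Gamma$ has computable F\o lner sets.
   Context: For a group $\Gamma$ generated by a finite set $X$, let $\pi_{\Gamma,X}\colon \mathbb F_X\to\Gamma$ be the canonical epimorphism from the free group on $X$. For a positive integer $n$, an $n$-F\o lner set of $\Gamma$ (with respect to $X$) is a non-empty finite subset $F\subset\Gamma$ with $\frac{|F\setminus xF|}{|F|}\le n^{-1}$ for all $x\in X$. $\Gamma$ is amenable if it admits $n$-F\o lner sets for all $n$. $\Gamma$ has computable F\o lner sets (with respect to $X$) if there is an algorithm which, on input $n$, outputs a finite subset $F\subset\mathbb F_X$ such that $\pi_{\Gamma,X}(F)$ is $n$-F\o lner for $\Gamma$. This property does not depend on the choice of the finite generating set. For $N$ regarded as a normal subgroup of $\Gamma$, with $Y$ a finite generating set of $N$ and $X$ a finite generating set of $\Gamma$, the distortion function is $\Delta_N^{\Gamma}(n):=\max\{|\omega|_Y:\ \omega\in N,\ |\omega|_X\le n\}$, where $|\cdot|_X$ and $|\cdot|_Y$ denote word length with respect to $X\cup X^{-1}$ and $Y\cup Y^{-1}$. A function $\mathbb N\to\mathbb N$ is subrecursive if it is bounded above by a recursive (total computable) function. *)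

theory Defs
  imports Complex_Main "HOL-Algebra.Generated_Groups" "HOL-Library.Nat_Bijection"
begin

section \<open>Total recursive functions\<close>

text \<open>
  The class of total recursive functions in the style of Kleene: minimisation is applied only to
  functions that have a zero for every choice of the parameters, so partial functions never arise.
  In \<open>total_recursive k f\<close> the function \<open>f\<close> is regarded as a \<open>k\<close>-ary function; its values on lists
  of length other than \<open>k\<close> carry no meaning.
\<close>

inductive total_recursive :: "nat \<Rightarrow> (nat list \<Rightarrow> nat) \<Rightarrow> bool" where
  zero: "total_recursive k (\<lambda>_. 0)"
| succ: "total_recursive 1 (\<lambda>xs. Suc (xs ! 0))"
| proj: "i < k \<Longrightarrow> total_recursive k (\<lambda>xs. xs ! i)"
| comp: "total_recursive (length gs) f \<Longrightarrow> (\<And>g. g \<in> set gs \<Longrightarrow> total_recursive k g) \<Longrightarrow>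
           total_recursive k (\<lambda>xs. f (map (\<lambda>g. g xs) gs))"
| prim_rec: "total_recursive k f \<Longrightarrow> total_recursive (Suc (Suc k)) g \<Longrightarrow>
           total_recursive (Suc k) (\<lambda>xs. rec_nat (f (tl xs)) (\<lambda>m r. g (m # r # tl xs)) (hd xs))"
| minimise: "total_recursive (Suc k) f \<Longrightarrow> (\<And>xs. length xs = k \<Longrightarrow> \<exists>y. f (y # xs) = 0) \<Longrightarrow>
           total_recursive k (\<lambda>xs. LEAST y. f (y # xs) = 0)"

definition recursive_function :: "(nat \<Rightarrow> nat) \<Rightarrow> bool" where
  "recursive_function f \<longleftrightarrow> (\<exists>F. total_recursive 1 F \<and> (\<forall>n. F [n] = f n))"

definition subrecursive :: "(nat \<Rightarrow> nat) \<Rightarrow> bool" where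
  "subrecursive f \<longleftrightarrow> (\<exists>g. recursive_function g \<and> (\<forall>n. f n \<le> g n))"


section \<open>Words and free groups\<close>

text \<open>The letter \<open>(x, True)\<close> stands for the generator \<open>x\<close>, the letter \<open>(x, False)\<close> for its formal inverse.\<close>

type_synonym 'x word = "('x \<times> bool) list"

definition words :: "'x set \<Rightarrow> 'x word set" where
  "words X = lists (X \<times> UNIV)"

inductive cancel :: "'x set \<Rightarrow> 'x word \<Rightarrow> 'x word \<Rightarrow> bool" for X where
  "u \<in> words X \<Longrightarrow> v \<in> words X \<Longrightarrow> x \<in> X \<Longrightarrow> cancel X (u @ [(x, b), (x, \<not> b)] @ v) (u @ v)"

definition freely_equal :: "'x set \<Rightarrow> 'x word rel" where
  "freely_equal X = {(u, v). u \<in> words X \<and> v \<in> words X \<and> equivclp (cancel X) u v}"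

definition free_class :: "'x set \<Rightarrow> 'x word \<Rightarrow> 'x word set" where
  "free_class X w = freely_equal X `` {w}"

definition free_group :: "'x set \<Rightarrow> 'x word set monoid" where
  "free_group X = \<lparr>carrier = words X // freely_equal X,
     mult = (\<lambda>A B. freely_equal X `` {u @ v | u v. u \<in> A \<and> v \<in> B}),
     one = free_class X []\<rparr>"

fun word_value :: "('g, 'a) monoid_scheme \<Rightarrow> 'g word \<Rightarrow> 'g" where
  "word_value G [] = \<one>\<^bsub>G\<^esub>"
| "word_value G ((x, b) # w) = (if b then x else inv\<^bsub>G\<^esub> x) \<otimes>\<^bsub>G\<^esub> word_value G w"

text \<open>All words in a class have the same value in \<open>G\<close>, see \<open>canonical_epi_free_class\<close> below.\<close>

definition canonical_epi :: "('g, 'a) monoid_scheme \<Rightarrow> 'g word set \<Rightarrow> 'g" where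
  "canonical_epi G A = the_elem (word_value G ` A)"

definition finite_generating_set :: "('g, 'a) monoid_scheme \<Rightarrow> 'g set \<Rightarrow> bool" where
  "finite_generating_set G X \<longleftrightarrow> finite X \<and> X \<subseteq> carrier G \<and> generate G X = carrier G"


section \<open>Coding of words and of finite subsets of a free group\<close>

text \<open>
  A finite set \<open>X\<close> is numbered by a list \<open>xs\<close> without repetitions. Words over \<open>X\<close> are coded by numbers
  through the corresponding words over the indices \<open>{..<length xs}\<close>, and a finite subset of the free
  group on \<open>X\<close> is coded by a list of words that represent its elements. Which numbering of the finite
  set \<open>X\<close> is used does not affect computability.
\<close>

definition word_code :: "nat word \<Rightarrow> nat" where
  "word_code w = list_encode (map (\<lambda>(i, b). 2 * i + of_bool b) w)"

definition index_word :: "'x list \<Rightarrow> nat word \<Rightarrow> 'x word" where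
  "index_word xs = map (\<lambda>(i, b). (xs ! i, b))"

definition codes_subset :: "'x list \<Rightarrow> nat \<Rightarrow> 'x word set set \<Rightarrow> bool" where
  "codes_subset xs c F \<longleftrightarrow>
     (\<exists>ws. set ws \<subseteq> words {..<length xs} \<and> c = list_encode (map word_code ws) \<and>
           F = (\<lambda>w. free_class (set xs) (index_word xs w)) ` set ws)"


section \<open>Folner sets, word problem, distortion\<close>

definition folner_set :: "('g, 'a) monoid_scheme \<Rightarrow> 'g set \<Rightarrow> nat \<Rightarrow> 'g set \<Rightarrow> bool" where
  "folner_set G X n F \<longleftrightarrow> F \<noteq> {} \<and> finite F \<and> F \<subseteq> carrier G \<and>
     (\<forall>x\<in>X. real (card (F - (x <#\<^bsub>G\<^esub> F))) / real (card F) \<le> inverse (real n))"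

definition amenable :: "('g, 'a) monoid_scheme \<Rightarrow> 'g set \<Rightarrow> bool" where
  "amenable G X \<longleftrightarrow> (\<forall>n>0. \<exists>F. folner_set G X n F)"

definition computable_folner_sets :: "('g, 'a) monoid_scheme \<Rightarrow> 'g set \<Rightarrow> bool" where
  "computable_folner_sets G X \<longleftrightarrow>
     (\<exists>xs f. distinct xs \<and> set xs = X \<and> recursive_function f \<and>
        (\<forall>n>0. \<exists>F. codes_subset xs (f n) F \<and> folner_set G X n (canonical_epi G ` F)))"

definition solvable_word_problem :: "('g, 'a) monoid_scheme \<Rightarrow> 'g set \<Rightarrow> bool" where
  "solvable_word_problem G X \<longleftrightarrow>
     (\<exists>xs f. distinct xs \<and> set xs = X \<and> recursive_function f \<and>
        (\<forall>w\<in>words {..<length xs}.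
           f (word_code w) =
             (if canonical_epi G (free_class X (index_word xs w)) = \<one>\<^bsub>G\<^esub> then 1 else 0)))"

definition word_length :: "('g, 'a) monoid_scheme \<Rightarrow> 'g set \<Rightarrow> 'g \<Rightarrow> nat" where
  "word_length G X g = (LEAST l. \<exists>w\<in>words X. length w = l \<and> word_value G w = g)"

text \<open>The group \<open>N\<close> is regarded as a subgroup of \<open>G\<close> by means of the embedding \<open>\<iota>\<close>.\<close>

definition distortion ::
  "('n, 'a) monoid_scheme \<Rightarrow> 'n set \<Rightarrow> ('g, 'b) monoid_scheme \<Rightarrow> 'g set \<Rightarrow> ('n \<Rightarrow> 'g) \<Rightarrow> nat \<Rightarrow> nat" where
  "distortion N Y G X \<iota> n =
     Max {word_length N Y h | h. h \<in> carrier N \<and> word_length G X (\<iota> h) \<le> n}"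

text \<open>
  The predicate \<open>short_exact_sequence\<close> of HOL-Algebra forces all groups of the sequence to have the
  same element type.
\<close>

definition short_exact ::
  "('n, 'a) monoid_scheme \<Rightarrow> ('g, 'b) monoid_scheme \<Rightarrow> ('k, 'c) monoid_scheme \<Rightarrow>
     ('n \<Rightarrow> 'g) \<Rightarrow> ('g \<Rightarrow> 'k) \<Rightarrow> bool" where
  "short_exact N G K \<iota> \<pi> \<longleftrightarrow>
     group N \<and> group G \<and> group K \<and> \<iota> \<in> mon N G \<and> \<pi> \<in> epi G K \<and> \<iota> ` carrier N = kernel G K \<pi>"


section \<open>The free group and its canonical epimorphism\<close>

lemma words_append [simp]: "u @ v \<in> words X \<longleftrightarrow> u \<in> words X \<and> v \<in> words X"
  by (auto simp: words_def)

lemma words_Nil [simp]: "[] \<in> words X"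
  by (auto simp: words_def)

lemma words_Cons [simp]: "(x, b) # w \<in> words X \<longleftrightarrow> x \<in> X \<and> w \<in> words X"
  by (auto simp: words_def)

lemma equiv_freely_equal: "equiv (words X) (freely_equal X)"
proof (rule equivI)
  show "freely_equal X \<subseteq> words X \<times> words X"
    by (auto simp: freely_equal_def)
  show "refl_on (words X) (freely_equal X)"
    by (auto simp: freely_equal_def refl_on_def)
  show "sym (freely_equal X)"
    by (auto simp: freely_equal_def sym_def intro: equivclp_sym)
  show "trans (freely_equal X)"
    by (auto simp: freely_equal_def trans_def intro: equivclp_trans)
qed

lemma freely_equal_context:
  assumes "(u, v) \<in> freely_equal X" "p \<in> words X" "q \<in> words X"
  shows "(p @ u @ q, p @ v @ q) \<in> freely_equal X"
proof -
  have "equivclp (cancel X) (p @ u @ q) (p @ v @ q)" if "equivclp (cancel X) u v"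
    using that
  proof (induction rule: equivclp_induct)
    case base
    show ?case by simp
  next
    case (step y z)
    have *: "cancel X (p @ y @ q) (p @ z @ q)" if "cancel X y z" for y z
      using that
    proof cases
      case (1 a c x b)
      then show ?thesis
        using cancel.intros[of "p @ a" X "c @ q" x b] assms(2,3) by simp
    qed
    from step(2) have "equivclp (cancel X) (p @ y @ q) (p @ z @ q)"
      using * by (meson r_into_equivclp equivclp_sym)
    with step.IH show ?case by (rule equivclp_trans)
  qed
  with assms show ?thesis by (auto simp: freely_equal_def)
qed

lemma freely_equal_append:
  assumes "(u, u') \<in> freely_equal X" "(v, v') \<in> freely_equal X"
  shows "(u @ v, u' @ v') \<in> freely_equal X"
proof -
  from assms have W: "u' \<in> words X" "v \<in> words X" by (auto simp: freely_equal_def)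
  have "(u @ v, u' @ v) \<in> freely_equal X"
    using freely_equal_context[OF assms(1), of "[]" v] W by simp
  moreover have "(u' @ v, u' @ v') \<in> freely_equal X"
    using freely_equal_context[OF assms(2), of u' "[]"] W by simp
  ultimately show ?thesis
    using equiv_freely_equal[of X] by (meson equivE transD)
qed

lemma free_class_eq_iff:
  "u \<in> words X \<Longrightarrow> v \<in> words X \<Longrightarrow> free_class X u = free_class X v \<longleftrightarrow> (u, v) \<in> freely_equal X"
  unfolding free_class_def using equiv_freely_equal[of X] by (simp add: eq_equiv_class_iff)

lemma self_in_free_class: "w \<in> words X \<Longrightarrow> w \<in> free_class X w"
  by (simp add: free_class_def freely_equal_def)

lemma carrier_free_group: "carrier (free_group X) = free_class X ` words X"
  by (auto simp: free_group_def free_class_def quotient_def)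

lemma mult_free_class:
  assumes "u \<in> words X" "v \<in> words X"
  shows "free_class X u \<otimes>\<^bsub>free_group X\<^esub> free_class X v = free_class X (u @ v)"
proof -
  have E: "equiv (words X) (freely_equal X)" by (rule equiv_freely_equal)
  have "freely_equal X `` {a @ b | a b. a \<in> free_class X u \<and> b \<in> free_class X v}
          = freely_equal X `` {u @ v}" (is "?L = ?R")
  proof
    show "?L \<subseteq> ?R"
    proof
      fix z assume "z \<in> ?L"
      then obtain a b where "(u, a) \<in> freely_equal X" "(v, b) \<in> freely_equal X"
        "(a @ b, z) \<in> freely_equal X" by (auto simp: free_class_def)
      with freely_equal_append[of u a X v b] E show "z \<in> ?R"
        by (meson Image_singleton_iff equivE transD)
    qed
    show "?R \<subseteq> ?L"
      using self_in_free_class[OF assms(1)] self_in_free_class[OF assms(2)] by blast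
  qed
  then show ?thesis by (simp add: free_group_def free_class_def)
qed

lemma one_free_group: "\<one>\<^bsub>free_group X\<^esub> = free_class X []"
  by (simp add: free_group_def)

lemma word_inverse_exists:
  assumes "w \<in> words X"
  shows "\<exists>v\<in>words X. (v @ w, []) \<in> freely_equal X"
  using assms
proof (induction w)
  case Nil
  then show ?case by (auto simp: freely_equal_def intro!: bexI[of _ "[]"])
next
  case (Cons a w)
  obtain x b where a: "a = (x, b)" by (cases a)
  with Cons obtain v where v: "v \<in> words X" "(v @ w, []) \<in> freely_equal X" by auto
  have X: "x \<in> X" "w \<in> words X" using Cons.prems a by auto
  have "cancel X (v @ [(x, \<not> b), (x, \<not> \<not> b)] @ w) (v @ w)"
    using v X by (intro cancel.intros)
  then have "((v @ [(x, \<not> b)]) @ a # w, v @ w) \<in> freely_equal X"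
    using v X a by (auto simp: freely_equal_def)
  with v(2) have "((v @ [(x, \<not> b)]) @ a # w, []) \<in> freely_equal X"
    using equiv_freely_equal[of X] by (meson equivE transD)
  with v X show ?case by (intro bexI[of _ "v @ [(x, \<not> b)]"]) auto
qed

lemma group_free_group: "group (free_group X)"
proof (rule groupI)
  fix A assume "A \<in> carrier (free_group X)"
  then obtain w where w: "w \<in> words X" "A = free_class X w" by (auto simp: carrier_free_group)
  then obtain v where "v \<in> words X" "(v @ w, []) \<in> freely_equal X"
    using word_inverse_exists by blast
  with w show "\<exists>B\<in>carrier (free_group X). B \<otimes>\<^bsub>free_group X\<^esub> A = \<one>\<^bsub>free_group X\<^esub>"
    by (intro bexI[of _ "free_class X v"])
       (auto simp: carrier_free_group one_free_group mult_free_class free_class_eq_iff)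
qed (auto simp: carrier_free_group one_free_group mult_free_class)

context group
begin

lemma word_value_closed: "X \<subseteq> carrier G \<Longrightarrow> w \<in> words X \<Longrightarrow> word_value G w \<in> carrier G"
  by (induction w) auto

lemma word_value_append:
  assumes "X \<subseteq> carrier G" "u \<in> words X" "v \<in> words X"
  shows "word_value G (u @ v) = word_value G u \<otimes> word_value G v"
  using assms(2)
proof (induction u)
  case Nil
  then show ?case using word_value_closed[OF assms(1,3)] by simp
next
  case (Cons a u)
  then show ?case
    using word_value_closed[OF assms(1)] assms by (cases a) (auto simp: m_assoc)
qed

lemma word_value_cancel:
  assumes "X \<subseteq> carrier G" "cancel X u v"
  shows "word_value G u = word_value G v"
  using assms(2)
proof cases
  case (1 p q x b)
  have x: "x \<in> carrier G" and q: "word_value G q \<in> carrier G"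
    using 1 assms(1) word_value_closed by auto
  have "word_value G ([(x, b), (x, \<not> b)] @ q) = word_value G q"
    using x q by (simp add: m_assoc[symmetric])
  moreover have "[(x, b), (x, \<not> b)] @ q \<in> words X" using 1 by simp
  ultimately show ?thesis
    using 1 assms(1) by (metis word_value_append)
qed

lemma word_value_freely_equal:
  assumes "X \<subseteq> carrier G" "(u, v) \<in> freely_equal X"
  shows "word_value G u = word_value G v"
proof -
  from assms(2) have "equivclp (cancel X) u v" by (simp add: freely_equal_def)
  then show ?thesis
  proof (induction rule: equivclp_induct)
    case (step y z)
    then show ?case
      using word_value_cancel[OF assms(1), of y z] word_value_cancel[OF assms(1), of z y] by auto
  qed simp
qed

lemma canonical_epi_free_class:
  assumes "X \<subseteq> carrier G" "w \<in> words X"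
  shows "canonical_epi G (free_class X w) = word_value G w"
proof -
  have "word_value G ` free_class X w = {word_value G w}"
  proof (intro equalityI subsetI)
    fix g assume "g \<in> word_value G ` free_class X w"
    then obtain v where "g = word_value G v" "(w, v) \<in> freely_equal X"
      by (auto simp: free_class_def)
    then show "g \<in> {word_value G w}"
      using word_value_freely_equal[OF assms(1), of w v] by simp
  qed (use self_in_free_class[OF assms(2)] in blast)
  then show ?thesis by (simp add: canonical_epi_def)
qed

lemma canonical_epi_generator:
  assumes "X \<subseteq> carrier G" "x \<in> X"
  shows "canonical_epi G (free_class X [(x, True)]) = x"
  using canonical_epi_free_class[OF assms(1), of "[(x, True)]"] assms by auto

lemma canonical_epi_hom:
  assumes "X \<subseteq> carrier G"
  shows "canonical_epi G \<in> hom (free_group X) G"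
  by (rule homI)
     (auto simp: carrier_free_group mult_free_class canonical_epi_free_class[OF assms]
        word_value_closed[OF assms] word_value_append[OF assms])

lemma canonical_epi_is_epi:
  assumes "finite_generating_set G X"
  shows "canonical_epi G \<in> epi (free_group X) G"
proof -
  have X: "X \<subseteq> carrier G" "generate G X = carrier G"
    using assms by (auto simp: finite_generating_set_def)
  have "\<exists>w\<in>words X. word_value G w = g" if "g \<in> generate G X" for g
    using that
  proof induction
    case one
    show ?case by (intro bexI[of _ "[]"]) auto
  next
    case (incl h)
    then show ?case using X by (intro bexI[of _ "[(h, True)]"]) auto
  next
    case (inv h)
    then show ?case using X by (intro bexI[of _ "[(h, False)]"]) auto
  next
    case (eng h1 h2)
    then obtain u v where "u \<in> words X" "v \<in> words X" "word_value G u = h1" "word_value G v = h2"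
      by blast
    then show ?case using word_value_append[OF X(1)] by (intro bexI[of _ "u @ v"]) auto
  qed
  then have "carrier G \<subseteq> canonical_epi G ` carrier (free_group X)"
    using X canonical_epi_free_class[OF X(1)] by (force simp: carrier_free_group)
  with canonical_epi_hom[OF X(1)] show ?thesis
    by (auto simp: epi_def hom_def)
qed

end

end

theory Submission
  imports Defs
begin

text \<open>
  Let \<open>U\<close> be a finite set of representatives in \<open>\<Gamma>\<close> of a Folner set of \<open>K\<close>, and let \<open>A\<close> be a Folner
  set of \<open>N\<close>. For a generator \<open>x\<close> of \<open>\<Gamma>\<close> and \<open>v \<in> U\<close>, either \<open>x v\<close> leaves \<open>U N\<close>, which is
  rare, or \<open>x v = u c\<close> with \<open>u \<in> U\<close> and \<open>c \<in> N\<close>. Hence the product set \<open>U A\<close> is almost invariant under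
  \<open>x\<close> as soon as \<open>A\<close> is almost invariant under the finitely many elements \<open>c = inv u x v\<close>
  (\<open>displacement_extension\<close>).

  To make this effective, \<open>U\<close> is found first, by unbounded search: the word problem of \<open>K\<close> decides
  whether two words over generators of \<open>\<Gamma>\<close> agree in \<open>K\<close>, therefore whether a list of words represents
  an almost invariant set, and amenability of \<open>K\<close> makes the search succeed
  (\<open>computable_quotient_folner\<close>). Once \<open>U\<close> is known, so is a bound on the length in \<open>\<Gamma>\<close> of the
  elements \<open>c\<close>. What counts for \<open>A\<close>, however, is their length in \<open>N\<close>, because a set that
  is almost invariant under generators moves under \<open>c\<close> by at most the length of \<open>c\<close> times as much
  (\<open>displacement_word\<close>). The recursive bound on the distortion turns the first length into the second
  and thus yields the precision with which \<open>A\<close> has to be computed.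

  For the computability part, algorithms are expressed as HOL functions on types whose elements have
  codes; a function is computable if a recursive function performs it on codes. This class is
  closed under the usual operations on lists, in particular folds (\<open>computable_fold\<close>), and under
  search (\<open>computable_search\<close>). Words over one finite generating set are
  rewritten over another letter by letter through a finite table (\<open>numeric_value_translation\<close>), and
  a change of generators affects displacements by a constant factor only
  (\<open>displacement_change_generators\<close>).
\<close>

section \<open>Closure properties of total recursive functions\<close>

text \<open>
  The values of a total recursive function on lists of the wrong length carry no meaning.
  Identifying functions that agree on lists of length \<open>k\<close> lets the
  closure properties speak of the functions of interest only.
\<close>

definition rec_on :: "nat \<Rightarrow> (nat list \<Rightarrow> nat) \<Rightarrow> bool" where
  "rec_on k f \<longleftrightarrow> (\<exists>F. total_recursive k F \<and> (\<forall>xs. length xs = k \<longrightarrow> F xs = f xs))"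

lemma rec_onI: "total_recursive k F \<Longrightarrow> (\<And>xs. length xs = k \<Longrightarrow> F xs = f xs) \<Longrightarrow> rec_on k f"
  by (auto simp: rec_on_def)

lemma rec_on_cong: "rec_on k f \<Longrightarrow> (\<And>xs. length xs = k \<Longrightarrow> f xs = g xs) \<Longrightarrow> rec_on k g"
  by (auto simp: rec_on_def)

lemma rec_on_proj: "i < k \<Longrightarrow> rec_on k (\<lambda>xs. xs ! i)"
  by (auto intro: rec_onI total_recursive.proj)

lemma rec_on_zero: "rec_on k (\<lambda>_. 0)"
  by (auto intro: rec_onI total_recursive.zero)

lemma rec_on_comp:
  assumes "rec_on (length gs) f" "\<And>g. g \<in> set gs \<Longrightarrow> rec_on k g"
  shows "rec_on k (\<lambda>xs. f (map (\<lambda>g. g xs) gs))"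
proof -
  obtain F where F: "total_recursive (length gs) F" "\<And>xs. length xs = length gs \<Longrightarrow> F xs = f xs"
    using assms(1) by (auto simp: rec_on_def)
  have "\<forall>g\<in>set gs. \<exists>G. total_recursive k G \<and> (\<forall>xs. length xs = k \<longrightarrow> G xs = g xs)"
    using assms(2) by (auto simp: rec_on_def)
  then obtain G where G: "\<And>g. g \<in> set gs \<Longrightarrow> total_recursive k (G g)"
    "\<And>g xs. g \<in> set gs \<Longrightarrow> length xs = k \<Longrightarrow> G g xs = g xs"
    by metis
  have "total_recursive k (\<lambda>xs. F (map (\<lambda>g. g xs) (map G gs)))"
    using F(1) G(1) by (intro total_recursive.comp) auto
  then show ?thesis
    by (rule rec_onI) (use F(2) G(2) in \<open>auto simp: comp_def intro!: arg_cong[of _ _ f]\<close>)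
qed

lemma rec_on_prim_rec:
  assumes "rec_on k f" "rec_on (Suc (Suc k)) g"
  shows "rec_on (Suc k) (\<lambda>xs. rec_nat (f (tl xs)) (\<lambda>m r. g (m # r # tl xs)) (hd xs))"
proof -
  obtain F G where F: "total_recursive k F" "\<And>xs. length xs = k \<Longrightarrow> F xs = f xs"
    and G: "total_recursive (Suc (Suc k)) G" "\<And>xs. length xs = Suc (Suc k) \<Longrightarrow> G xs = g xs"
    using assms by (auto simp: rec_on_def)
  have "rec_nat (F ys) (\<lambda>m r. G (m # r # ys)) n = rec_nat (f ys) (\<lambda>m r. g (m # r # ys)) n"
    if "length ys = k" for ys n
    by (induction n) (use that F(2) G(2) in auto)
  then show ?thesis
    by (intro rec_onI[OF total_recursive.prim_rec[OF F(1) G(1)]]) auto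
qed

lemma rec_on_minimise:
  assumes "rec_on (Suc k) f" "\<And>xs. length xs = k \<Longrightarrow> \<exists>y. f (y # xs) = 0"
  shows "rec_on k (\<lambda>xs. LEAST y. f (y # xs) = 0)"
proof -
  obtain F where F: "total_recursive (Suc k) F" "\<And>xs. length xs = Suc k \<Longrightarrow> F xs = f xs"
    using assms(1) by (auto simp: rec_on_def)
  then have "total_recursive k (\<lambda>xs. LEAST y. F (y # xs) = 0)"
    using assms(2) by (intro total_recursive.minimise) auto
  then show ?thesis by (rule rec_onI) (use F(2) in auto)
qed

abbreviation "rec1 f \<equiv> rec_on (Suc 0) (\<lambda>xs. f (xs ! 0))"
abbreviation "rec2 f \<equiv> rec_on 2 (\<lambda>xs. f (xs ! 0) (xs ! 1))"
abbreviation "rec3 f \<equiv> rec_on 3 (\<lambda>xs. f (xs ! 0) (xs ! 1) (xs ! 2))"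

text \<open>
  In the following rules the outer function is of fixed arity and is given in curried form.
\<close>

lemma rec_on_comp1: "rec1 f \<Longrightarrow> rec_on k g \<Longrightarrow> rec_on k (\<lambda>xs. f (g xs))"
  using rec_on_comp[of "[g]" "\<lambda>xs. f (xs ! 0)" k] by simp

lemma rec_on_comp2: "rec2 f \<Longrightarrow> rec_on k g \<Longrightarrow> rec_on k h \<Longrightarrow> rec_on k (\<lambda>xs. f (g xs) (h xs))"
  using rec_on_comp[of "[g, h]" "\<lambda>xs. f (xs ! 0) (xs ! 1)" k] by (auto simp: numeral_2_eq_2)

lemma rec_on_Suc: "rec_on k g \<Longrightarrow> rec_on k (\<lambda>xs. Suc (g xs))"
  by (rule rec_on_comp1[of Suc]) (use total_recursive.succ in \<open>auto simp: rec_on_def\<close>)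

lemma rec_on_const: "rec_on k (\<lambda>_. c)"
  by (induction c) (auto intro: rec_on_zero rec_on_Suc)

lemma rec1_prim_rec:
  assumes "rec2 h"
  shows "rec1 (\<lambda>n. rec_nat c h n)"
proof -
  have "rec_on (Suc 0) (\<lambda>xs. rec_nat c (\<lambda>m r. h m r) (hd xs))"
    using rec_on_prim_rec[of 0 "\<lambda>_. c" "\<lambda>xs. h (xs ! 0) (xs ! 1)"] assms rec_on_const[of 0 c]
    by (simp add: numeral_2_eq_2)
  then show ?thesis
    by (rule rec_on_cong) (auto simp: length_Suc_conv)
qed

lemma rec2_prim_rec:
  assumes "rec1 f" "rec3 h"
  shows "rec2 (\<lambda>n x. rec_nat (f x) (\<lambda>m r. h m r x) n)"
proof -
  have "rec_on (Suc (Suc 0)) (\<lambda>xs. rec_nat (f (tl xs ! 0)) (\<lambda>m r. h m r (tl xs ! 0)) (hd xs))"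
    using rec_on_prim_rec[of "Suc 0" "\<lambda>xs. f (xs ! 0)" "\<lambda>xs. h (xs ! 0) (xs ! 1) (xs ! 2)"] assms
    by (simp add: numeral_3_eq_3)
  then show ?thesis
    unfolding numeral_2_eq_2 by (rule rec_on_cong) (auto simp: length_Suc_conv)
qed

lemma rec1_minimise:
  assumes "rec2 f" "\<And>x. \<exists>y. f y x = 0"
  shows "rec1 (\<lambda>x. LEAST y. f y x = 0)"
proof -
  show ?thesis
    using rec_on_minimise[of "Suc 0" "\<lambda>xs. f (xs ! 0) (xs ! 1)"] assms
    by (simp add: numeral_2_eq_2)
qed

lemma rec2_add: "rec2 (+)"
proof -
  have "rec2 (\<lambda>n x. rec_nat x (\<lambda>m r. Suc r) n)"
    by (intro rec2_prim_rec rec_on_proj rec_on_Suc) auto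
  moreover have "rec_nat x (\<lambda>m r. Suc r) n = n + x" for n x :: nat by (induction n) auto
  ultimately show ?thesis by simp
qed

lemma rec2_mult: "rec2 (*)"
proof -
  have "rec2 (\<lambda>n x. rec_nat ((\<lambda>_. 0) x) (\<lambda>m r. r + x) n)"
    by (intro rec2_prim_rec[of "\<lambda>_. 0"] rec_on_proj rec_on_comp2[OF rec2_add] rec_on_zero) auto
  moreover have "rec_nat 0 (\<lambda>m r. r + x) n = n * x" for n x :: nat by (induction n) auto
  ultimately show ?thesis by simp
qed

lemma rec1_pred: "rec1 (\<lambda>n. n - 1)"
proof -
  have "rec1 (\<lambda>n. rec_nat 0 (\<lambda>m r. m) n)"
    by (intro rec1_prim_rec rec_on_proj) auto
  moreover have "rec_nat 0 (\<lambda>m r. m) n = n - 1" for n :: nat by (cases n) auto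
  ultimately show ?thesis by simp
qed

lemma rec2_diff: "rec2 (-)"
proof -
  have "rec2 (\<lambda>n x. rec_nat x (\<lambda>m r. r - 1) n)"
    by (intro rec2_prim_rec rec_on_proj rec_on_comp1[OF rec1_pred]) auto
  moreover have "rec_nat x (\<lambda>m r. r - 1) n = x - n" for n x :: nat by (induction n) auto
  ultimately have "rec2 (\<lambda>n x. x - n)" by simp
  from rec_on_comp2[OF this, of 2 "\<lambda>xs. xs ! 1" "\<lambda>xs. xs ! 0"] show ?thesis
    by (simp add: rec_on_proj)
qed

lemma rec1_triangle: "rec1 triangle"
proof -
  have "rec1 (\<lambda>n. rec_nat 0 (\<lambda>m r. r + Suc m) n)"
    by (intro rec1_prim_rec rec_on_proj rec_on_comp2[OF rec2_add] rec_on_Suc) auto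
  moreover have "rec_nat 0 (\<lambda>m r. r + Suc m) n = triangle n" for n :: nat by (induction n) auto
  ultimately show ?thesis by simp
qed

lemma rec2_prod_encode: "rec2 (\<lambda>a b. prod_encode (a, b))"
  unfolding prod_encode_def prod.case
  by (intro rec_on_comp2[OF rec2_add] rec_on_comp1[OF rec1_triangle] rec_on_proj) auto

text \<open>The diagonal of a pair is the least \<open>s\<close> for which the code lies below the next triangular number.\<close>

lemma prod_decode_triangle:
  fixes c :: nat
  defines "s \<equiv> LEAST s. Suc c - triangle (Suc s) = 0"
  shows "prod_decode c = (c - triangle s, s - (c - triangle s))"
proof -
  obtain a b where ab: "c = prod_encode (a, b)" by (metis prod_decode_inverse prod.collapse)
  have mono: "triangle m \<le> triangle n" if "m \<le> n" for m n
    using that by (induction rule: dec_induct) auto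
  have "s = a + b"
    unfolding s_def
  proof (rule Least_equality)
    show "Suc c - triangle (Suc (a + b)) = 0" by (simp add: ab prod_encode_def)
    fix y assume y: "Suc c - triangle (Suc y) = 0"
    show "a + b \<le> y"
    proof (rule ccontr)
      assume "\<not> a + b \<le> y"
      then have "triangle (Suc y) \<le> triangle (a + b)" by (intro mono) auto
      with y show False by (simp add: ab prod_encode_def)
    qed
  qed
  then have "c - triangle s = a" by (simp add: ab prod_encode_def)
  with \<open>s = a + b\<close> ab show ?thesis by simp
qed

lemma rec1_prod_decode: "rec1 (\<lambda>c. fst (prod_decode c))" "rec1 (\<lambda>c. snd (prod_decode c))"
proof -
  define s where "s = (\<lambda>c. LEAST s. Suc c - triangle (Suc s) = 0)"
  have "\<exists>s. Suc c - triangle (Suc s) = 0" for c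
    by (rule exI[of _ c]) simp
  moreover have "rec2 (\<lambda>s c. Suc c - triangle (Suc s))"
    by (intro rec_on_comp2[OF rec2_diff] rec_on_comp1[OF rec1_triangle] rec_on_Suc rec_on_proj) auto
  ultimately have s: "rec1 s"
    unfolding s_def by (intro rec1_minimise)
  have 1: "rec1 (\<lambda>c. c - triangle (s c))"
    by (intro rec_on_comp2[OF rec2_diff] rec_on_comp1[OF rec1_triangle] s rec_on_proj) auto
  have 2: "rec1 (\<lambda>c. s c - (c - triangle (s c)))"
    by (intro rec_on_comp2[OF rec2_diff] 1 s)
  from 1 show "rec1 (\<lambda>c. fst (prod_decode c))"
    by (simp add: prod_decode_triangle s_def)
  from 2 show "rec1 (\<lambda>c. snd (prod_decode c))"
    by (simp add: prod_decode_triangle s_def)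
qed

lemma recursive_function_iff: "recursive_function f \<longleftrightarrow> rec1 f"
  unfolding recursive_function_def rec_on_def by (force simp: length_Suc_conv)

section \<open>Computability on coded data\<close>

text \<open>
  Computability is lifted to pairs, lists and truth values along codings by numbers, so that
  the algorithms below can be written as ordinary HOL functions. The code of a list of lists of
  numbers agrees with the code that describes a finite subset of a free group.
\<close>

class coded =
  fixes encode :: "'a \<Rightarrow> nat"

instantiation nat :: coded begin
definition [simp]: "(encode :: nat \<Rightarrow> nat) = (\<lambda>n. n)"
instance ..
end

instantiation bool :: coded begin
definition encode_bool :: "bool \<Rightarrow> nat" where [simp]: "encode_bool b = of_bool b"
instance ..
end

instantiation prod :: (coded, coded) coded begin
definition encode_prod :: "'a \<times> 'b \<Rightarrow> nat" where
  [simp]: "encode_prod p = prod_encode (encode (fst p), encode (snd p))"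
instance ..
end

instantiation list :: (coded) coded begin
definition encode_list :: "'a list \<Rightarrow> nat" where
  [simp]: "encode_list xs = list_encode (map encode xs)"
instance ..
end

definition computable :: "('a::coded \<Rightarrow> 'b::coded) \<Rightarrow> bool" where
  "computable f \<longleftrightarrow> (\<exists>g. rec1 g \<and> (\<forall>x. g (encode x) = encode (f x)))"

lemma computableI: "rec1 g \<Longrightarrow> (\<And>x. g (encode x) = encode (f x)) \<Longrightarrow> computable f"
  by (auto simp: computable_def)

lemma computable_nat_iff: "computable (f :: nat \<Rightarrow> nat) \<longleftrightarrow> rec1 f"
  by (simp add: computable_def fun_eq_iff[symmetric])

lemma recursive_function_iff_computable: "recursive_function f \<longleftrightarrow> computable f"
  by (simp add: recursive_function_iff computable_nat_iff)

lemma computable_comp: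
  assumes "computable f" "computable g" shows "computable (\<lambda>x. f (g x))"
proof -
  from assms obtain F G where "rec1 F" "\<And>x. F (encode x) = encode (f x)"
    "rec1 G" "\<And>x. G (encode x) = encode (g x)"
    unfolding computable_def by blast
  then show ?thesis
    by (intro computableI[of "\<lambda>x. F (G x)"]) (auto intro: rec_on_comp1[of F])
qed

named_theorems computable_intros

lemma computable_id [computable_intros]: "computable (\<lambda>x. x)"
  by (rule computableI[of "\<lambda>x. x"]) (auto intro: rec_on_proj)

lemma computable_const [computable_intros]: "computable (\<lambda>_. c)"
  by (rule computableI[of "\<lambda>_. encode c"]) (auto intro: rec_on_const)

lemma computable_Pair [computable_intros]:
  assumes "computable f" "computable g" shows "computable (\<lambda>x. (f x, g x))"
proof -
  from assms obtain F G where "rec1 F" "\<And>x. F (encode x) = encode (f x)"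
    "rec1 G" "\<And>x. G (encode x) = encode (g x)"
    unfolding computable_def by blast
  then show ?thesis
    by (intro computableI[of "\<lambda>x. prod_encode (F x, G x)"] rec_on_comp2[OF rec2_prod_encode]) auto
qed

lemma computable_fst [computable_intros]: "computable f \<Longrightarrow> computable (\<lambda>x. fst (f x))"
  by (rule computable_comp[of fst])
     (auto intro!: computableI[of "\<lambda>c. fst (prod_decode c)"] rec1_prod_decode)

lemma computable_snd [computable_intros]: "computable f \<Longrightarrow> computable (\<lambda>x. snd (f x))"
  by (rule computable_comp[of snd])
     (auto intro!: computableI[of "\<lambda>c. snd (prod_decode c)"] rec1_prod_decode)

lemma computable_rec2:
  fixes f g :: "'a::coded \<Rightarrow> nat"
  assumes "rec2 h" "computable f" "computable g"
  shows "computable (\<lambda>x. h (f x) (g x))"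
proof -
  have "rec1 (\<lambda>c. h (fst (prod_decode c)) (snd (prod_decode c)))"
    by (intro rec_on_comp2[OF assms(1)] rec1_prod_decode)
  then have "computable (\<lambda>p. h (fst p) (snd p))"
    by (intro computableI) auto
  from computable_comp[OF this computable_Pair[OF assms(2,3)]] show ?thesis by simp
qed

lemmas computable_add [computable_intros] = computable_rec2[OF rec2_add]
lemmas computable_mult [computable_intros] = computable_rec2[OF rec2_mult]
lemmas computable_diff [computable_intros] = computable_rec2[OF rec2_diff]

lemma computable_Suc [computable_intros]: "computable f \<Longrightarrow> computable (\<lambda>x. Suc (f x))"
  by (rule computable_comp[of Suc]) (auto simp: computable_nat_iff intro: rec_on_Suc rec_on_proj)

text \<open>
  Only codes matter. This rule changes the type of the values at no cost, which serves to
  treat codes as numbers, to do arithmetic on them, and to decode numbers.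
\<close>

lemma computable_recode:
  assumes "computable f" "\<And>x. encode (g x) = encode (f x)" shows "computable g"
  using assms by (auto simp: computable_def)

lemma computable_encode: "computable f \<Longrightarrow> computable (\<lambda>x. encode (f x))"
  by (rule computable_recode) auto

text \<open>
  The case distinction is arithmetic on codes: the code of a truth value is 0 or 1.
\<close>

lemma computable_if [computable_intros]:
  assumes "computable P" "computable f" "computable g"
  shows "computable (\<lambda>x. if P x then f x else g x)"
proof -
  have "computable (\<lambda>x. encode (P x) * encode (f x) + (1 - encode (P x)) * encode (g x))"
    by (intro computable_intros assms computable_encode)
  then show ?thesis by (rule computable_recode) simp
qed

lemma computable_not [computable_intros]:
  assumes "computable P" shows "computable (\<lambda>x. \<not> P x)"
proof -
  have "computable (\<lambda>x. if P x then False else True)"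
    by (intro computable_if computable_const assms)
  then show ?thesis by (rule computable_recode) simp
qed

lemma computable_conj [computable_intros]:
  assumes "computable P" "computable Q" shows "computable (\<lambda>x. P x \<and> Q x)"
proof -
  have "computable (\<lambda>x. if P x then Q x else False)"
    by (intro computable_if computable_const assms)
  then show ?thesis by (rule computable_recode) simp
qed

lemma computable_le [computable_intros]:
  fixes f g :: "'a::coded \<Rightarrow> nat"
  assumes "computable f" "computable g" shows "computable (\<lambda>x. f x \<le> g x)"
proof -
  have "computable (\<lambda>x. 1 - (f x - g x))" by (intro computable_intros assms)
  then show ?thesis by (rule computable_recode) auto
qed

lemma computable_eq [computable_intros]:
  fixes f g :: "'a::coded \<Rightarrow> nat"
  assumes "computable f" "computable g" shows "computable (\<lambda>x. f x = g x)"
  unfolding eq_iff by (intro computable_intros assms)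

lemma computable_less [computable_intros]:
  fixes f g :: "'a::coded \<Rightarrow> nat"
  assumes "computable f" "computable g" shows "computable (\<lambda>x. f x < g x)"
  unfolding less_eq_Suc_le by (intro computable_intros assms)

lemma computable_Cons [computable_intros]:
  assumes "computable f" "computable g" shows "computable (\<lambda>x. f x # g x)"
proof -
  have "computable (\<lambda>x. Suc (encode (f x, g x)))"
    by (intro computable_intros assms computable_encode)
  then show ?thesis by (rule computable_recode) simp
qed

lemma computable_funpow:
  fixes f :: "'b::coded \<Rightarrow> 'b"
  assumes "computable f" "computable n" "computable z"
  shows "computable (\<lambda>x. (f ^^ n x) (z x))"
proof -
  from assms(1) obtain F where F: "rec1 F" "\<And>x. F (encode x) = encode (f x)"
    unfolding computable_def by blast
  have "rec2 (\<lambda>n x. rec_nat x (\<lambda>m r. F r) n)"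
    by (intro rec2_prim_rec rec_on_comp1[OF F(1)] rec_on_proj) auto
  moreover have "rec_nat x (\<lambda>m r. F r) n = (F ^^ n) x" for n x by (induction n) auto
  ultimately have "rec2 (\<lambda>n. F ^^ n)" by simp
  then have *: "computable (\<lambda>x. (F ^^ n x) (encode (z x)))"
    by (rule computable_rec2) (intro assms computable_encode)+
  have "encode ((f ^^ n) z) = (F ^^ n) (encode z)" for n z
    by (induction n) (auto simp: F(2)[symmetric])
  then show ?thesis by (intro computable_recode[OF *]) simp
qed

lemma length_le_list_encode: "length xs \<le> list_encode xs"
proof (induction xs)
  case (Cons x xs)
  then show ?case using le_prod_encode_2[of "list_encode xs" x] by simp
qed simp

text \<open>A fold over a list iterates, on the code of the list, the step that consumes the head and does
  nothing on the empty list; the code of a list bounds its length.\<close>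

lemma computable_fold:
  fixes h :: "'p::coded \<Rightarrow> 'a::coded \<Rightarrow> 's::coded \<Rightarrow> 's"
  assumes h: "computable (\<lambda>q. h (fst q) (fst (snd q)) (snd (snd q)))"
    and "computable xs" "computable s"
  shows "computable (\<lambda>p. fold (h p) (xs p) (s p))"
proof -
  from h obtain H where H: "rec1 H"
    "\<And>q. H (encode q) = encode (h (fst q) (fst (snd q)) (snd (snd q)))"
    unfolding computable_def by blast
  define step where "step = (\<lambda>(p::nat, c::nat, s::nat). if c = 0 then (p, c, s) else
    (p, snd (prod_decode (c - 1)), H (encode (p, fst (prod_decode (c - 1)), s))))"
  have D: "computable prod_decode"
    by (rule computableI[of "\<lambda>n. n"]) (auto intro: rec_on_proj)
  have "computable step"
    unfolding step_def case_prod_unfold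
    by (intro computable_intros computable_comp[OF H(1)[folded computable_nat_iff]]
        computable_encode computable_comp[OF D])
  then have "computable (\<lambda>p. snd (snd ((step ^^ encode (xs p)) (encode p, encode (xs p), encode (s p)))))"
    by (intro computable_intros computable_funpow computable_encode assms(2,3))
  moreover have "snd (snd ((step ^^ n) (encode p, encode ys, encode t))) = encode (fold (h p) ys t)"
    if "length ys \<le> n" for n p ys t
    using that
  proof (induction n arbitrary: ys t)
    case (Suc n)
    show ?case
    proof (cases ys)
      case Nil
      have "(step ^^ m) (encode p, 0, encode t) = (encode p, 0, encode t)" for m
        by (induction m) (auto simp: step_def)
      with Nil show ?thesis by (simp del: funpow.simps)
    next
      case (Cons y zs)
      then have "step (encode p, encode ys, encode t) = (encode p, encode zs, encode (h p y t))"
        using H(2)[of "(p, y, t)"] by (simp add: step_def)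
      with Suc Cons show ?thesis by (simp add: funpow_Suc_right del: funpow.simps)
    qed
  qed simp
  moreover have "length (xs p) \<le> encode (xs p)" for p
    using length_le_list_encode[of "map encode (xs p)"] by simp
  ultimately show ?thesis by (elim computable_recode) simp
qed

lemma computable_rev [computable_intros]: "computable xs \<Longrightarrow> computable (\<lambda>p. rev (xs p))"
  unfolding rev_conv_fold by (intro computable_fold computable_intros)

lemma computable_foldr:
  fixes h :: "'p::coded \<Rightarrow> 'a::coded \<Rightarrow> 's::coded \<Rightarrow> 's"
  assumes "computable (\<lambda>q. h (fst q) (fst (snd q)) (snd (snd q)))" "computable xs" "computable s"
  shows "computable (\<lambda>p. foldr (h p) (xs p) (s p))"
  unfolding foldr_conv_fold by (intro computable_fold computable_intros assms)

lemma computable_append [computable_intros]: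
  assumes "computable f" "computable g" shows "computable (\<lambda>p. f p @ g p)"
proof -
  have "computable (\<lambda>p. foldr (#) (f p) (g p))"
    by (intro computable_foldr computable_intros assms)
  moreover have "foldr (#) xs ys = xs @ ys" for xs ys :: "'b list" by (induction xs) auto
  ultimately show ?thesis by simp
qed

lemma computable_concat [computable_intros]:
  "computable f \<Longrightarrow> computable (\<lambda>p. concat (f p))"
  unfolding concat_conv_foldr by (intro computable_foldr computable_intros)

lemma computable_map [computable_intros]:
  assumes "computable (\<lambda>q. h (fst q) (snd q))" "computable xs"
  shows "computable (\<lambda>p. map (h p) (xs p))"
proof -
  have h: "computable (\<lambda>q::'a \<times> 'b \<times> 'c list. h (fst q) (fst (snd q)))"
    using computable_comp[OF assms(1), of "\<lambda>q::'a \<times> 'b \<times> 'c list. (fst q, fst (snd q))"]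
    by (simp add: computable_intros)
  have "computable (\<lambda>p. foldr (\<lambda>x ys. h p x # ys) (xs p) [])"
    by (intro computable_foldr computable_intros h assms(2))
  moreover have "foldr (\<lambda>x ys. f x # ys) xs [] = map f xs" for f :: "'b \<Rightarrow> 'c" and xs
    by (induction xs) auto
  ultimately show ?thesis by simp
qed

lemma computable_filter [computable_intros]:
  assumes "computable (\<lambda>q. P (fst q) (snd q))" "computable xs"
  shows "computable (\<lambda>p. filter (P p) (xs p))"
proof -
  have "computable (\<lambda>p. concat (map (\<lambda>x. if P p x then [x] else []) (xs p)))"
    by (intro computable_intros assms)
  moreover have "concat (map (\<lambda>x. if Q x then [x] else []) xs) = filter Q xs" for Q and xs :: "'b list"
    by (induction xs) auto
  ultimately show ?thesis by simp
qed

lemma computable_sum_list [computable_intros]: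
  fixes xs :: "'a::coded \<Rightarrow> nat list"
  assumes "computable xs" shows "computable (\<lambda>p. sum_list (xs p))"
  unfolding sum_list.eq_foldr by (intro computable_foldr computable_intros assms)

lemma computable_length [computable_intros]:
  assumes "computable xs" shows "computable (\<lambda>p. length (xs p))"
proof -
  have "computable (\<lambda>p. sum_list (map (\<lambda>_. 1 :: nat) (xs p)))" by (intro computable_intros assms)
  then show ?thesis by (simp add: sum_list_triv)
qed

lemma computable_list_all [computable_intros]:
  assumes "computable (\<lambda>q. P (fst q) (snd q))" "computable xs"
  shows "computable (\<lambda>p. list_all (P p) (xs p))"
proof -
  have "computable (\<lambda>p. length (filter (\<lambda>x. \<not> P p x) (xs p)) = 0)"
    by (intro computable_intros assms)
  moreover have "length (filter (\<lambda>x. \<not> Q x) xs) = 0 \<longleftrightarrow> list_all Q xs" for Q and xs :: "'b list"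
    by (induction xs) auto
  ultimately show ?thesis by simp
qed

text \<open>
  A function with finitely many exceptional values is computable whatever these values are;
  this is how non-constructively chosen translations of letters enter an algorithm.
\<close>

lemma computable_table:
  fixes t :: "nat \<Rightarrow> 'a::coded"
  shows "computable (\<lambda>n. if n < k then t n else d)"
proof (induction k)
  case (Suc k)
  have "computable (\<lambda>n. if n = k then t k else if n < k then t n else d)"
    by (intro computable_intros Suc)
  also have "(\<lambda>n. if n = k then t k else if n < k then t n else d) = (\<lambda>n. if n < Suc k then t n else d)"
    by (auto simp: less_Suc_eq)
  finally show ?case .
qed (simp add: computable_const)

lemma computable_Least:
  fixes P :: "nat \<Rightarrow> nat \<Rightarrow> bool"
  assumes "computable (\<lambda>q. P (fst q) (snd q))" "\<And>n. \<exists>y. P n y"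
  shows "computable (\<lambda>n. LEAST y. P n y)"
proof -
  obtain F where F: "rec1 F" "\<And>q. F (encode q) = encode (P (fst q) (snd q))"
    using assms(1) unfolding computable_def by blast
  have "rec2 (\<lambda>y n. 1 - F (prod_encode (n, y)))"
    by (intro rec_on_comp2[OF rec2_diff] rec_on_const rec_on_comp1[OF F(1)]
        rec_on_comp2[OF rec2_prod_encode] rec_on_proj) auto
  moreover have *: "1 - F (prod_encode (n, y)) = 0 \<longleftrightarrow> P n y" for n y
    using F(2)[of "(n, y)"] by simp
  ultimately show ?thesis
    using rec1_minimise[of "\<lambda>y n. 1 - F (prod_encode (n, y))"] assms(2) 
    unfolding computable_nat_iff * by blast
qed

section \<open>Displacement of finite sets and word length\<close>

text \<open>
  How far \<open>F\<close> is from being invariant under \<open>g\<close>. Unlike the ratio in the definition of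
  a Folner set it is a length function in \<open>g\<close>: subadditive and symmetric.
\<close>

definition displacement :: "('g, 'a) monoid_scheme \<Rightarrow> 'g set \<Rightarrow> 'g \<Rightarrow> nat" where
  "displacement G F g = card (F - (g <#\<^bsub>G\<^esub> F))"

lemma folner_set_iff:
  assumes "n > 0"
  shows "folner_set G X n F \<longleftrightarrow> F \<noteq> {} \<and> finite F \<and> F \<subseteq> carrier G \<and>
    (\<forall>x\<in>X. n * displacement G F x \<le> card F)"
proof -
  have "real d / real c \<le> inverse (real n) \<longleftrightarrow> n * d \<le> c" if "c > 0" for d c
  proof -
    have "real d / real c \<le> inverse (real n) \<longleftrightarrow> real n * real d \<le> real c"
      using assms that by (simp add: field_simps)
    then show ?thesis by (metis of_nat_le_iff of_nat_mult)
  qed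
  then show ?thesis
    unfolding folner_set_def displacement_def by (metis card_gt_0_iff)
qed

context group
begin

lemma l_coset_conv_image: "g <# F = (\<lambda>h. g \<otimes> h) ` F"
  by (auto simp: l_coset_def)

lemma card_l_coset:
  assumes "g \<in> carrier G" "F \<subseteq> carrier G" shows "card (g <# F) = card F"
  unfolding l_coset_conv_image using assms by (intro card_image inj_onI) (metis Units_eq Units_l_cancel subsetD)

lemma l_coset_diff:
  assumes "g \<in> carrier G" "A \<subseteq> carrier G" "B \<subseteq> carrier G"
  shows "g <# (A - B) = (g <# A) - (g <# B)"
  unfolding l_coset_conv_image using assms
  by (intro inj_on_image_set_diff[of _ "carrier G"] inj_onI) auto

lemma displacement_one: "F \<subseteq> carrier G \<Longrightarrow> displacement G F \<one> = 0"
  by (simp add: displacement_def lcos_mult_one)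

lemma displacement_mult:
  assumes "finite F" "F \<subseteq> carrier G" "g \<in> carrier G" "h \<in> carrier G"
  shows "displacement G F (g \<otimes> h) \<le> displacement G F g + displacement G F h"
proof -
  have hF: "h <# F \<subseteq> carrier G" using assms by (simp add: l_coset_subset_G)
  have "F - (g \<otimes> h <# F) \<subseteq> (F - (g <# F)) \<union> (g <# (F - (h <# F)))"
    using assms hF by (auto simp: l_coset_diff lcos_m_assoc)
  moreover have "finite (g <# (F - (h <# F)))" using assms by (simp add: l_coset_conv_image)
  ultimately have "displacement G F (g \<otimes> h) \<le> card ((F - (g <# F)) \<union> (g <# (F - (h <# F))))"
    unfolding displacement_def using assms by (intro card_mono) auto
  also have "\<dots> \<le> card (F - (g <# F)) + card (g <# (F - (h <# F)))" by (rule card_Un_le)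
  also have "card (g <# (F - (h <# F))) = card (F - (h <# F))"
    using assms by (intro card_l_coset) auto
  finally show ?thesis by (simp add: displacement_def)
qed

lemma displacement_inv:
  assumes "finite F" "F \<subseteq> carrier G" "g \<in> carrier G"
  shows "displacement G F (inv g) = displacement G F g"
proof -
  have gF: "g <# F \<subseteq> carrier G" "finite (g <# F)" "card (g <# F) = card F"
    using assms by (auto simp: l_coset_subset_G card_l_coset) (simp add: l_coset_conv_image)
  have "displacement G F (inv g) = card (g <# (F - (inv g <# F)))"
    unfolding displacement_def using assms by (intro card_l_coset[symmetric]) auto
  also have "g <# (F - (inv g <# F)) = (g <# F) - F"
    using assms by (simp add: l_coset_diff l_coset_subset_G lcos_m_assoc lcos_mult_one)
  also have "card \<dots> = card (F - (g <# F))"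
  proof -
    have "card (g <# F) = card ((g <# F) \<inter> F) + card ((g <# F) - F)"
      using gF by (metis card_Int_Diff)
    moreover have "card F = card (F \<inter> (g <# F)) + card (F - (g <# F))"
      using assms by (metis card_Int_Diff)
    ultimately show ?thesis using gF by (simp add: Int_commute)
  qed
  finally show ?thesis by (simp add: displacement_def)
qed

text \<open>
  By subadditivity and symmetry of the displacement, every letter of the word costs at most what a
  generator costs.
\<close>

lemma displacement_word:
  assumes "finite F" "F \<subseteq> carrier G" "X \<subseteq> carrier G" "\<And>x. x \<in> X \<Longrightarrow> m * displacement G F x \<le> c"
    and "w \<in> words X"
  shows "m * displacement G F (word_value G w) \<le> length w * c"
  using assms(5)
proof (induction w)
  case Nil
  then show ?case using assms by (simp add: displacement_one)
next
  case (Cons a w)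
  obtain x b where a: "a = (x, b)" by (cases a)
  define y where "y = (if b then x else inv x)"
  have x: "x \<in> X" "w \<in> words X" "x \<in> carrier G" using Cons.prems a assms(3) by auto
  then have y: "y \<in> carrier G" "m * displacement G F y \<le> c"
    using assms(4)[of x] assms(1,2) by (auto simp: y_def displacement_inv)
  have "displacement G F (y \<otimes> word_value G w) \<le> displacement G F y + displacement G F (word_value G w)"
    using assms(1-3) x y by (intro displacement_mult word_value_closed)
  then have "m * displacement G F (y \<otimes> word_value G w)
      \<le> m * displacement G F y + m * displacement G F (word_value G w)"
    by (metis mult_le_mono2 distrib_left)
  also have "\<dots> \<le> c + length w * c" using y Cons.IH x by (intro add_mono) auto
  finally show ?case by (simp add: a y_def)
qed

lemma word_value_surj:
  assumes "finite_generating_set G X" "g \<in> carrier G"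
  shows "\<exists>w\<in>words X. word_value G w = g"
proof -
  have "g \<in> canonical_epi G ` carrier (free_group X)"
    using canonical_epi_is_epi[OF assms(1)] assms(2) by (auto simp: epi_def)
  then show ?thesis
    using assms(1) canonical_epi_free_class[of X]
    by (auto simp: carrier_free_group finite_generating_set_def)
qed

text \<open>
  The Folner condition on a generating set controls all other elements up to a factor that depends
  on the elements only, namely on the lengths of words that represent them. A positive factor is
  supplied so that it can be cancelled.
\<close>

lemma displacement_change_generators:
  assumes "finite_generating_set G X" "finite T" "T \<subseteq> carrier G"
  shows "\<exists>D>0. \<forall>m F. m > 0 \<longrightarrow> folner_set G X m F \<longrightarrow> (\<forall>t\<in>T. m * displacement G F t \<le> D * card F)"
proof -
  have "\<forall>t\<in>T. \<exists>w. w \<in> words X \<and> word_value G w = t"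
    using word_value_surj[OF assms(1)] assms(3) by blast
  then obtain w where w: "\<And>t. t \<in> T \<Longrightarrow> w t \<in> words X \<and> word_value G (w t) = t" by metis
  have X: "X \<subseteq> carrier G" using assms(1) by (simp add: finite_generating_set_def)
  have "m * displacement G F t \<le> Suc (\<Sum>t\<in>T. length (w t)) * card F"
    if "m > 0" "folner_set G X m F" "t \<in> T" for m F t
  proof -
    have "m * displacement G F (word_value G (w t)) \<le> length (w t) * card F"
      using that X w by (intro displacement_word[of F X]) (auto simp: folner_set_iff)
    also have "\<dots> \<le> Suc (\<Sum>t\<in>T. length (w t)) * card F"
      using that assms(2) by (intro mult_le_mono1 le_SucI member_le_sum) auto
    finally show ?thesis using w[OF that(3)] by simp
  qed
  then show ?thesis by blast
qed

lemma word_length_le: "w \<in> words X \<Longrightarrow> word_length G X (word_value G w) \<le> length w"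
  unfolding word_length_def by (rule Least_le) auto

lemma word_length_attained:
  assumes "finite_generating_set G X" "g \<in> carrier G"
  obtains w where "w \<in> words X" "length w = word_length G X g" "word_value G w = g"
proof -
  have "\<exists>l. \<exists>w\<in>words X. length w = l \<and> word_value G w = g"
    using word_value_surj[OF assms] by auto
  from LeastI_ex[OF this] show ?thesis using that unfolding word_length_def by auto
qed

lemma word_length_one: "word_length G X \<one> = 0"
  using word_length_le[of "[]" X] by simp

lemma word_length_mult:
  assumes "finite_generating_set G X" "g \<in> carrier G" "h \<in> carrier G"
  shows "word_length G X (g \<otimes> h) \<le> word_length G X g + word_length G X h"
proof -
  have X: "X \<subseteq> carrier G" using assms(1) by (simp add: finite_generating_set_def)
  obtain u where u: "u \<in> words X" "length u = word_length G X g" "word_value G u = g"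
    using word_length_attained[OF assms(1,2)] .
  obtain v where v: "v \<in> words X" "length v = word_length G X h" "word_value G v = h"
    using word_length_attained[OF assms(1,3)] .
  show ?thesis using word_length_le[of "u @ v" X] u v X by (simp add: word_value_append)
qed

lemma word_length_inv:
  assumes "finite_generating_set G X" "g \<in> carrier G"
  shows "word_length G X (inv g) \<le> word_length G X g"
proof -
  have X: "X \<subseteq> carrier G" using assms(1) by (simp add: finite_generating_set_def)
  have "\<exists>v\<in>words X. length v = length w \<and> word_value G v = inv (word_value G w)"
    if "w \<in> words X" for w using that
  proof (induction w)
    case (Cons a w)
    obtain x b where a: "a = (x, b)" by (cases a)
    with Cons obtain v where v: "v \<in> words X" "length v = length w"
      "word_value G v = inv (word_value G w)" by auto
    have x: "x \<in> X" "x \<in> carrier G" "w \<in> words X" using Cons.prems a X by auto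
    have "word_value G (v @ [(x, \<not> b)]) = inv (word_value G (a # w))"
      using a x v X word_value_closed[OF X, of w] by (simp add: word_value_append[OF X] inv_mult_group)
    with v x show ?case by (intro bexI[of _ "v @ [(x, \<not> b)]"]) auto
  qed auto
  moreover obtain w where "w \<in> words X" "length w = word_length G X g" "word_value G w = g"
    using word_length_attained[OF assms] .
  ultimately show ?thesis using word_length_le by metis
qed

lemma finite_word_length_ball:
  assumes "finite_generating_set G X"
  shows "finite {g \<in> carrier G. word_length G X g \<le> n}"
proof (rule finite_subset)
  show "{g \<in> carrier G. word_length G X g \<le> n}
      \<subseteq> word_value G ` {w. set w \<subseteq> X \<times> UNIV \<and> length w \<le> n}"
  proof safe
    fix g assume g: "g \<in> carrier G" "word_length G X g \<le> n"
    obtain w where "w \<in> words X" "length w = word_length G X g" "word_value G w = g"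
      using word_length_attained[OF assms g(1)] .
    with g(2) show "g \<in> word_value G ` {w. set w \<subseteq> X \<times> UNIV \<and> length w \<le> n}"
      by (auto simp: words_def)
  qed
  show "finite (word_value G ` {w. set w \<subseteq> X \<times> UNIV \<and> length w \<le> n})"
    using assms by (intro finite_imageI finite_lists_length_le) (auto simp: finite_generating_set_def)
qed

end

text \<open>
  The maximum in the distortion function is one over a finite set because \<open>\<iota>\<close> embeds this set
  into a ball of the word metric of \<open>G\<close>.
\<close>

lemma word_length_le_distortion:
  assumes "group G" "finite_generating_set G X" "\<iota> \<in> mon N G"
    and "h \<in> carrier N" "word_length G X (\<iota> h) \<le> n"
  shows "word_length N Y h \<le> distortion N Y G X \<iota> n"
proof -
  have "finite {h \<in> carrier N. word_length G X (\<iota> h) \<le> n}"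
  proof (rule inj_on_finite[of \<iota>])
    show "inj_on \<iota> {h \<in> carrier N. word_length G X (\<iota> h) \<le> n}"
      using assms(3) by (auto simp: mon_def intro: inj_on_subset)
    show "\<iota> ` {h \<in> carrier N. word_length G X (\<iota> h) \<le> n} \<subseteq> {g \<in> carrier G. word_length G X g \<le> n}"
      using assms(3) by (auto simp: mon_def hom_def)
    show "finite {g \<in> carrier G. word_length G X g \<le> n}"
      using group.finite_word_length_ball[OF assms(1,2)] .
  qed
  moreover have "{word_length N Y h |h. h \<in> carrier N \<and> word_length G X (\<iota> h) \<le> n}
      = word_length N Y ` {h \<in> carrier N. word_length G X (\<iota> h) \<le> n}" by auto
  ultimately show ?thesis
    unfolding distortion_def using assms(4,5) by (auto intro!: Max_ge)
qed

section \<open>Almost invariant sets in extensions\<close>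

text \<open>
  The geometric core. \<open>F\<close> is the union of the translates \<open>u A\<close>, which are disjoint since
  \<open>U\<close> lies injectively in the quotient. If \<open>\<pi> u\<close> is not in \<open>\<pi> x \<pi> U\<close>, the translate \<open>u A\<close>
  is given up as a whole; few \<open>u\<close> are of this kind as \<open>\<pi> U\<close> is almost invariant. Otherwise
  \<open>x v = u c\<close> for some \<open>v \<in> U\<close> and some \<open>c\<close> in the kernel, so that \<open>u (A \<inter> c A)\<close> lies in
  \<open>x F\<close>, and \<open>A\<close> is almost invariant under \<open>c\<close>.
\<close>

lemma displacement_extension:
  assumes ex: "short_exact N G K \<iota> \<pi>" and x: "x \<in> carrier G"
    and U: "finite U" "U \<subseteq> carrier G" "inj_on \<pi> U"
    and A: "finite A" "A \<subseteq> carrier N"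
    and pU: "p * displacement K (\<pi> ` U) (\<pi> x) \<le> card (\<pi> ` U)"
    and pA: "\<And>u v h. u \<in> U \<Longrightarrow> v \<in> U \<Longrightarrow> h \<in> carrier N \<Longrightarrow>
      \<iota> h = inv\<^bsub>G\<^esub> u \<otimes>\<^bsub>G\<^esub> x \<otimes>\<^bsub>G\<^esub> v \<Longrightarrow> p * displacement N A h \<le> card A"
  defines "F \<equiv> (\<lambda>(u, h). u \<otimes>\<^bsub>G\<^esub> \<iota> h) ` (U \<times> A)"
  shows "p * displacement G F x \<le> 2 * card F"
proof -
  interpret N: group N using ex by (simp add: short_exact_def)
  interpret G: group G using ex by (simp add: short_exact_def)
  interpret K: group K using ex by (simp add: short_exact_def)
  have \<iota>: "\<iota> \<in> hom N G" "inj_on \<iota> (carrier N)" and \<pi>: "\<pi> \<in> hom G K"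
    and ker: "\<iota> ` carrier N = kernel G K \<pi>"
    using ex by (auto simp: short_exact_def mon_def epi_def)
  interpret \<iota>: group_hom N G \<iota> using \<iota> by unfold_locales
  interpret \<pi>: group_hom G K \<pi> using \<pi> by unfold_locales
  have \<pi>\<iota>: "\<pi> (\<iota> h) = \<one>\<^bsub>K\<^esub>" if "h \<in> carrier N" for h
    using ker that by (auto simp: kernel_def)
  have inj: "inj_on (\<lambda>(u, h). u \<otimes>\<^bsub>G\<^esub> \<iota> h) (U \<times> A)"
  proof (rule inj_onI, clarify)
    fix u h u' h' assume *: "u \<in> U" "h \<in> A" "u' \<in> U" "h' \<in> A" "u \<otimes>\<^bsub>G\<^esub> \<iota> h = u' \<otimes>\<^bsub>G\<^esub> \<iota> h'"
    then have c: "u \<in> carrier G" "u' \<in> carrier G" "h \<in> carrier N" "h' \<in> carrier N" using U A by auto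
    have "\<pi> (u \<otimes>\<^bsub>G\<^esub> \<iota> h) = \<pi> (u' \<otimes>\<^bsub>G\<^esub> \<iota> h')" using * by simp
    then have "\<pi> u = \<pi> u'" using c by (simp add: \<pi>\<iota>)
    then have "u = u'" using U * by (auto dest: inj_onD)
    moreover from this have "\<iota> h = \<iota> h'" using * c by simp
    ultimately show "u = u' \<and> h = h'" using \<iota>(2) c by (auto dest: inj_onD)
  qed
  have cardF: "card F = card U * card A"
    unfolding F_def using inj by (simp add: card_image card_cartesian_product)
  \<comment> \<open>the elements whose whole translate may be lost\<close>
  define U0 where "U0 = {u \<in> U. \<pi> u \<notin> \<pi> x <#\<^bsub>K\<^esub> (\<pi> ` U)}"
  have "\<pi> ` U0 = \<pi> ` U - (\<pi> x <#\<^bsub>K\<^esub> (\<pi> ` U))" by (auto simp: U0_def)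
  then have "card U0 = displacement K (\<pi> ` U) (\<pi> x)"
    unfolding displacement_def using U(3)
    by (metis (no_types, lifting) U0_def card_image inj_on_subset mem_Collect_eq subsetI)
  with pU have U0: "p * card U0 \<le> card U" using U by (simp add: card_image)
  have "\<exists>c\<in>carrier N. \<exists>v\<in>U. \<iota> c = inv\<^bsub>G\<^esub> u \<otimes>\<^bsub>G\<^esub> x \<otimes>\<^bsub>G\<^esub> v" if "u \<in> U - U0" for u
  proof -
    from that obtain v where v: "v \<in> U" "\<pi> u = \<pi> x \<otimes>\<^bsub>K\<^esub> \<pi> v"
      by (auto simp: U0_def K.l_coset_conv_image)
    have c: "u \<in> carrier G" "v \<in> carrier G" using that v U by auto
    have "\<pi> (inv\<^bsub>G\<^esub> u \<otimes>\<^bsub>G\<^esub> x \<otimes>\<^bsub>G\<^esub> v) = inv\<^bsub>K\<^esub> (\<pi> u) \<otimes>\<^bsub>K\<^esub> (\<pi> x \<otimes>\<^bsub>K\<^esub> \<pi> v)"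
      using c x by (simp add: K.m_assoc)
    then have "\<pi> (inv\<^bsub>G\<^esub> u \<otimes>\<^bsub>G\<^esub> x \<otimes>\<^bsub>G\<^esub> v) = \<one>\<^bsub>K\<^esub>"
      using c unfolding v(2)[symmetric] by simp
    then have "inv\<^bsub>G\<^esub> u \<otimes>\<^bsub>G\<^esub> x \<otimes>\<^bsub>G\<^esub> v \<in> \<iota> ` carrier N"
      using c x by (simp add: ker kernel_def)
    then show ?thesis using v by force
  qed
  then obtain c v where c: "\<And>u. u \<in> U - U0 \<Longrightarrow> c u \<in> carrier N \<and> v u \<in> U \<and>
      \<iota> (c u) = inv\<^bsub>G\<^esub> u \<otimes>\<^bsub>G\<^esub> x \<otimes>\<^bsub>G\<^esub> v u" by metis
  \<comment> \<open>the part of the translate of \<open>A\<close> by \<open>u\<close> that may lie outside \<open>x F\<close>\<close>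
  define B where "B = (\<lambda>u. if u \<in> U0 then A else A - (c u <#\<^bsub>N\<^esub> A))"
  have sub: "F - (x <#\<^bsub>G\<^esub> F) \<subseteq> (\<Union>u\<in>U. (\<lambda>h. u \<otimes>\<^bsub>G\<^esub> \<iota> h) ` B u)"
  proof
    fix g assume g: "g \<in> F - (x <#\<^bsub>G\<^esub> F)"
    then obtain u h where uh: "u \<in> U" "h \<in> A" "g = u \<otimes>\<^bsub>G\<^esub> \<iota> h" by (auto simp: F_def)
    have "h \<in> B u"
    proof (rule ccontr)
      assume "h \<notin> B u"
      then have u: "u \<in> U - U0" and "h \<in> c u <#\<^bsub>N\<^esub> A" using uh by (auto simp: B_def split: if_splits)
      then obtain h' where h': "h' \<in> A" "h = c u \<otimes>\<^bsub>N\<^esub> h'" by (auto simp: N.l_coset_conv_image)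
      have cc: "u \<in> carrier G" "v u \<in> carrier G" "h' \<in> carrier N" "c u \<in> carrier N"
        using c[OF u] U A uh h' by auto
      have "g = u \<otimes>\<^bsub>G\<^esub> (inv\<^bsub>G\<^esub> u \<otimes>\<^bsub>G\<^esub> x \<otimes>\<^bsub>G\<^esub> v u \<otimes>\<^bsub>G\<^esub> \<iota> h')"
        using uh h' cc c[OF u] by simp
      also have "\<dots> = x \<otimes>\<^bsub>G\<^esub> (v u \<otimes>\<^bsub>G\<^esub> \<iota> h')"
        using cc x by (simp add: G.m_assoc[symmetric])
      finally have "g = x \<otimes>\<^bsub>G\<^esub> (v u \<otimes>\<^bsub>G\<^esub> \<iota> h')" .
      moreover have "v u \<otimes>\<^bsub>G\<^esub> \<iota> h' \<in> F" using c[OF u] h' by (auto simp: F_def)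
      ultimately show False using g by (auto simp: G.l_coset_conv_image)
    qed
    with uh show "g \<in> (\<Union>u\<in>U. (\<lambda>h. u \<otimes>\<^bsub>G\<^esub> \<iota> h) ` B u)" by auto
  qed
  have finB: "finite (B u)" for u using A by (simp add: B_def)
  have "displacement G F x \<le> card (\<Union>u\<in>U. (\<lambda>h. u \<otimes>\<^bsub>G\<^esub> \<iota> h) ` B u)"
    unfolding displacement_def using sub U finB by (intro card_mono) auto
  also have "\<dots> \<le> (\<Sum>u\<in>U. card ((\<lambda>h. u \<otimes>\<^bsub>G\<^esub> \<iota> h) ` B u))"
    using U by (intro card_UN_le)
  also have "\<dots> \<le> (\<Sum>u\<in>U. card (B u))"
    using finB by (intro sum_mono card_image_le)
  finally have "p * displacement G F x \<le> (\<Sum>u\<in>U. p * card (B u))"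
    by (metis mult_le_mono2 sum_distrib_left)
  also have "\<dots> \<le> (\<Sum>u\<in>U. (if u \<in> U0 then p * card A else 0) + card A)"
  proof (rule sum_mono)
    fix u assume "u \<in> U"
    then show "p * card (B u) \<le> (if u \<in> U0 then p * card A else 0) + card A"
      using pA[of u "v u" "c u"] c[of u] by (auto simp: B_def displacement_def)
  qed
  also have "\<dots> = p * card U0 * card A + card U * card A"
  proof -
    have "U \<inter> {u. u \<in> U0} = U0" by (auto simp: U0_def)
    then show ?thesis using U by (simp add: sum.distrib sum.If_cases)
  qed
  also have "\<dots> \<le> card U * card A + card U * card A" using U0 by simp
  finally show ?thesis by (simp add: cardF)
qed

section \<open>Words as lists of numbers\<close>

text \<open>
  The letter coded by \<open>2 * i + 1\<close> is the generator \<open>xs ! i\<close>, the letter coded by \<open>2 * i\<close> its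
  inverse. Numbers that code no letter get the value \<open>\<one>\<close>: then every list of numbers has a value,
  and searches may range over all lists instead of over words only.
\<close>

definition letter_value :: "('g, 'a) monoid_scheme \<Rightarrow> 'g list \<Rightarrow> nat \<Rightarrow> 'g" where
  "letter_value G xs l = (if l < 2 * length xs
     then if odd l then xs ! (l div 2) else inv\<^bsub>G\<^esub> (xs ! (l div 2)) else \<one>\<^bsub>G\<^esub>)"

primrec numeric_value :: "('g, 'a) monoid_scheme \<Rightarrow> 'g list \<Rightarrow> nat list \<Rightarrow> 'g" where
  "numeric_value G xs [] = \<one>\<^bsub>G\<^esub>"
| "numeric_value G xs (l # w) = letter_value G xs l \<otimes>\<^bsub>G\<^esub> numeric_value G xs w"

definition proper_letters :: "'g list \<Rightarrow> nat list \<Rightarrow> nat list" where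
  "proper_letters xs w = filter (\<lambda>l. l < 2 * length xs) w"

definition word_of_numbers :: "nat list \<Rightarrow> nat word" where
  "word_of_numbers = map (\<lambda>l. (l div 2, odd l))"

definition numbers_of_word :: "nat word \<Rightarrow> nat list" where
  "numbers_of_word = map (\<lambda>(i, b). 2 * i + of_bool b)"

lemma word_of_numbers_inverse: "numbers_of_word (word_of_numbers w) = w"
  by (induction w) (auto simp: numbers_of_word_def word_of_numbers_def)

lemma word_code_eq: "word_code w = list_encode (numbers_of_word w)"
  by (simp add: word_code_def numbers_of_word_def)

lemma word_of_numbers_in_words:
  "\<forall>l\<in>set w. l < 2 * k \<Longrightarrow> word_of_numbers w \<in> words {..<k}"
  by (induction w) (auto simp: word_of_numbers_def)

lemma index_word_in_words: "w \<in> words {..<length xs} \<Longrightarrow> index_word xs w \<in> words (set xs)"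
  by (induction w) (auto simp: index_word_def)

lemma numeric_value_numbers_of_word:
  "w \<in> words {..<length xs} \<Longrightarrow> numeric_value G xs (numbers_of_word w) = word_value G (index_word xs w)"
proof (induction w)
  case (Cons a w)
  obtain i b where a: "a = (i, b)" by (cases a)
  have "letter_value G xs (2 * i + of_bool b) = (if b then xs ! i else inv\<^bsub>G\<^esub> (xs ! i))"
    using Cons.prems a by (auto simp: letter_value_def)
  with a Cons show ?case by (simp add: numbers_of_word_def index_word_def)
qed (simp add: numbers_of_word_def index_word_def)

lemma proper_letters_less: "l \<in> set (proper_letters xs w) \<Longrightarrow> l < 2 * length xs"
  by (simp add: proper_letters_def)

lemma computable_proper_letters [computable_intros]:
  "computable f \<Longrightarrow> computable (\<lambda>p. proper_letters xs (f p))"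
  unfolding proper_letters_def by (intro computable_intros)

context group
begin

lemma letter_value_closed: "set xs \<subseteq> carrier G \<Longrightarrow> letter_value G xs l \<in> carrier G"
  using nth_mem[of "l div 2" xs] by (auto simp: letter_value_def intro!: inv_closed)

lemma numeric_value_closed: "set xs \<subseteq> carrier G \<Longrightarrow> numeric_value G xs w \<in> carrier G"
  by (induction w) (auto simp: letter_value_closed)

lemma numeric_value_append:
  "set xs \<subseteq> carrier G \<Longrightarrow> numeric_value G xs (u @ v) = numeric_value G xs u \<otimes> numeric_value G xs v"
  by (induction u) (auto simp: letter_value_closed numeric_value_closed m_assoc)

lemma numeric_value_proper_letters:
  "set xs \<subseteq> carrier G \<Longrightarrow> numeric_value G xs (proper_letters xs w) = numeric_value G xs w"
  by (induction w) (auto simp: proper_letters_def numeric_value_closed letter_value_def)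

lemma numeric_value_surj:
  assumes "finite_generating_set G (set xs)" "g \<in> carrier G"
  shows "\<exists>w. numeric_value G xs w = g"
proof -
  obtain w where w: "w \<in> words (set xs)" "word_value G w = g"
    using word_value_surj[OF assms] by blast
  have "\<exists>v\<in>words {..<length xs}. index_word xs v = w"
    using w(1)
  proof (induction w)
    case (Cons a w)
    then obtain x b v where *: "a = (x, b)" "x \<in> set xs" "v \<in> words {..<length xs}" "index_word xs v = w"
      by (cases a) auto
    then obtain i where "i < length xs" "xs ! i = x" by (auto simp: in_set_conv_nth)
    with * show ?case by (intro bexI[of _ "(i, b) # v"]) (auto simp: index_word_def)
  qed (auto simp: index_word_def)
  with w numeric_value_numbers_of_word show ?thesis by metis
qed

text \<open>
  Decoding needs no knowledge of the words behind the code: the values of the decoded lists already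
  determine the set in the group.
\<close>

lemma codes_subset_value:
  assumes "codes_subset xs c F" "set xs \<subseteq> carrier G"
  shows "canonical_epi G ` F = numeric_value G xs ` set (map list_decode (list_decode c))"
proof -
  obtain ws where ws: "set ws \<subseteq> words {..<length xs}" "c = list_encode (map word_code ws)"
    "F = (\<lambda>w. free_class (set xs) (index_word xs w)) ` set ws"
    using assms(1) by (auto simp: codes_subset_def)
  have "canonical_epi G (free_class (set xs) (index_word xs w)) = numeric_value G xs (numbers_of_word w)"
    if "w \<in> set ws" for w
    using that ws(1) assms(2) index_word_in_words
    by (subst canonical_epi_free_class) (auto simp: numeric_value_numbers_of_word)
  then have "canonical_epi G ` F = numeric_value G xs ` numbers_of_word ` set ws"
    unfolding ws(3) image_image by (rule image_cong[OF refl])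
  then show ?thesis by (simp add: ws(2) word_code_eq comp_def image_image)
qed

lemma codes_subset_proper_letters:
  assumes "\<And>w l. w \<in> set ws \<Longrightarrow> l \<in> set w \<Longrightarrow> l < 2 * length xs" "set xs \<subseteq> carrier G"
  shows "\<exists>F. codes_subset xs (encode ws) F \<and> canonical_epi G ` F = numeric_value G xs ` set ws"
proof -
  define F where "F = (\<lambda>w. free_class (set xs) (index_word xs w)) ` set (map word_of_numbers ws)"
  have "codes_subset xs (encode ws) F"
    unfolding codes_subset_def F_def using assms(1)
    by (intro exI[of _ "map word_of_numbers ws"])
       (auto simp: word_code_eq word_of_numbers_inverse comp_def intro: word_of_numbers_in_words cong: map_cong)
  with codes_subset_value[OF this assms(2)] show ?thesis
    by (intro exI[of _ F]) (simp add: comp_def)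
qed

text \<open>
  Surjectivity of the evaluation gives some word for each of the finitely many letters, and a finite
  table is computable.
\<close>

lemma letter_translation:
  assumes "finite_generating_set G (set xs)" "\<And>l. c l \<in> carrier G" "\<And>l. l \<ge> k \<Longrightarrow> c l = \<one>"
  shows "\<exists>t :: nat \<Rightarrow> nat list. computable t \<and> (\<forall>l. numeric_value G xs (t l) = c l)"
proof -
  have "\<forall>l. \<exists>w. numeric_value G xs w = c l"
    using numeric_value_surj[OF assms(1) assms(2)] by blast
  then obtain t where t: "\<And>l. numeric_value G xs (t l) = c l" by (metis (no_types))
  have "numeric_value G xs (if l < k then t l else []) = c l" for l
    using assms(3)[of l] by (simp add: t)
  then show ?thesis
    by (intro exI[of _ "\<lambda>l. if l < k then t l else []"] conjI computable_table) simp
qed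

lemma numeric_value_inverse:
  assumes "finite_generating_set G (set xs)"
  shows "\<exists>I. computable I \<and> (\<forall>w. numeric_value G xs (I w) = inv (numeric_value G xs w))"
proof -
  have xs: "set xs \<subseteq> carrier G" using assms by (simp add: finite_generating_set_def)
  note closed = letter_value_closed[OF xs] numeric_value_closed[OF xs]
  have "\<exists>t :: nat \<Rightarrow> nat list. computable t \<and>
      (\<forall>l. numeric_value G xs (t l) = inv (letter_value G xs l))"
    by (rule letter_translation[OF assms, of _ "2 * length xs"])
       (simp_all add: closed, simp add: letter_value_def)
  then obtain t :: "nat \<Rightarrow> nat list" where t: "computable t"
    "\<And>l. numeric_value G xs (t l) = inv (letter_value G xs l)" by blast
  have "numeric_value G xs (concat (map t (rev w))) = inv (numeric_value G xs w)" for w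
    by (induction w) (simp_all add: t(2) numeric_value_append[OF xs] closed inv_mult_group)
  moreover have "computable (\<lambda>w. concat (map t (rev w)))"
    by (intro computable_intros computable_comp[OF t(1)])
  ultimately show ?thesis by (intro exI[of _ "\<lambda>w. concat (map t (rev w))"]) simp
qed

end

lemma numeric_value_translation:
  assumes "group G" "group H" "\<phi> \<in> hom G H" "set xs \<subseteq> carrier G" "finite_generating_set H (set zs)"
  shows "\<exists>T. computable T \<and> (\<forall>w. numeric_value H zs (T w) = \<phi> (numeric_value G xs w))"
proof -
  interpret \<phi>: group_hom G H \<phi> using assms by (simp add: group_hom_def group_hom_axioms_def)
  have zs: "set zs \<subseteq> carrier H" using assms(5) by (simp add: finite_generating_set_def)
  note closed = \<phi>.G.letter_value_closed[OF assms(4)] \<phi>.G.numeric_value_closed[OF assms(4)]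
  have "\<exists>t :: nat \<Rightarrow> nat list. computable t \<and>
      (\<forall>l. numeric_value H zs (t l) = \<phi> (letter_value G xs l))"
    by (rule \<phi>.H.letter_translation[OF assms(5), of _ "2 * length xs"])
       (simp_all add: closed, simp add: letter_value_def)
  then obtain t :: "nat \<Rightarrow> nat list" where t: "computable t"
    "\<And>l. numeric_value H zs (t l) = \<phi> (letter_value G xs l)" by blast
  have "numeric_value H zs (concat (map t w)) = \<phi> (numeric_value G xs w)" for w
    by (induction w) (simp_all add: t(2) closed \<phi>.H.numeric_value_append[OF zs])
  moreover have "computable (\<lambda>w. concat (map t w))"
    by (intro computable_intros computable_comp[OF t(1)])
  ultimately show ?thesis by (intro exI[of _ "\<lambda>w. concat (map t w)"]) simp
qed

lemma computable_is_one:
  assumes "group K" "finite_generating_set K Z" "solvable_word_problem K Z"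
  shows "\<exists>zs. set zs = Z \<and> computable (\<lambda>w. numeric_value K zs w = \<one>\<^bsub>K\<^esub>)"
proof -
  interpret group K by fact
  obtain zs f where zs: "set zs = Z" and f: "recursive_function f"
    "\<And>w. w \<in> words {..<length zs} \<Longrightarrow> f (word_code w) =
       (if canonical_epi K (free_class Z (index_word zs w)) = \<one>\<^bsub>K\<^esub> then 1 else 0)"
    using assms(3) unfolding solvable_word_problem_def by blast
  have Z: "Z \<subseteq> carrier K" using assms(2) by (simp add: finite_generating_set_def)
  have "f (encode (proper_letters zs w)) = 1 \<longleftrightarrow> numeric_value K zs w = \<one>\<^bsub>K\<^esub>" for w
  proof -
    define v where "v = word_of_numbers (proper_letters zs w)"
    have v: "v \<in> words {..<length zs}"
      unfolding v_def using proper_letters_less by (intro word_of_numbers_in_words) blast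
    have "canonical_epi K (free_class Z (index_word zs v)) = numeric_value K zs (numbers_of_word v)"
      using v index_word_in_words[OF v] zs Z
      by (simp add: canonical_epi_free_class numeric_value_numbers_of_word)
    also have "\<dots> = numeric_value K zs w"
      using zs Z by (simp add: v_def word_of_numbers_inverse numeric_value_proper_letters)
    finally show ?thesis
      using f(2)[OF v] by (simp add: word_code_eq v_def word_of_numbers_inverse)
  qed
  moreover have "computable (\<lambda>w. f (encode (proper_letters zs w)) = 1)"
    using f(1) unfolding recursive_function_iff_computable
    by (intro computable_intros computable_comp[where f = f and g = "\<lambda>w. encode (proper_letters zs w)"]
        computable_encode)
  ultimately show ?thesis using zs by auto
qed

text \<open>
  Words over generators of \<open>G\<close> are translated letter by letter into words over \<open>Z\<close>; equality of
  \<open>u\<close> and \<open>v\<close> in the quotient is triviality of \<open>u\<close> times the inverse of \<open>v\<close>.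
\<close>

lemma computable_quotient_equality:
  assumes "group G" "group K" "\<pi> \<in> hom G K" "finite_generating_set G (set xs)"
    and "finite_generating_set K Z" "solvable_word_problem K Z"
  shows "computable (\<lambda>q. \<pi> (numeric_value G xs (fst q)) = \<pi> (numeric_value G xs (snd q)))"
proof -
  interpret \<pi>: group_hom G K \<pi> using assms by (simp add: group_hom_def group_hom_axioms_def)
  have xs: "set xs \<subseteq> carrier G" using assms(4) by (simp add: finite_generating_set_def)
  obtain zs where zs: "set zs = Z" and dec: "computable (\<lambda>w. numeric_value K zs w = \<one>\<^bsub>K\<^esub>)"
    using computable_is_one[OF assms(2,5,6)] by blast
  obtain T where T: "computable T" "\<And>w. numeric_value K zs (T w) = \<pi> (numeric_value G xs w)"
    using numeric_value_translation[OF assms(1-3) xs, of zs] assms(5) zs by auto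
  obtain I where I: "computable I" "\<And>w. numeric_value G xs (I w) = inv\<^bsub>G\<^esub> (numeric_value G xs w)"
    using \<pi>.G.numeric_value_inverse[OF assms(4)] by blast
  note closed = \<pi>.G.numeric_value_closed[OF xs]
  have "computable (\<lambda>q. numeric_value K zs (T (fst q @ I (snd q))) = \<one>\<^bsub>K\<^esub>)"
    by (intro computable_comp[OF dec] computable_comp[OF T(1)] computable_comp[OF I(1)] computable_intros)
  moreover have "numeric_value K zs (T (u @ I v)) = \<one>\<^bsub>K\<^esub> \<longleftrightarrow>
      \<pi> (numeric_value G xs u) = \<pi> (numeric_value G xs v)" for u v
    using \<pi>.H.right_cancel[of "inv\<^bsub>K\<^esub> (\<pi> (numeric_value G xs v))" "\<pi> (numeric_value G xs u)" "\<pi> (numeric_value G xs v)"]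
    by (simp add: T(2) I(2) \<pi>.G.numeric_value_append[OF xs] closed)
  ultimately show ?thesis by simp
qed

text \<open>
  The length of a word over \<open>xs\<close> is computable, the length of its value with respect to \<open>X\<close>
  need not be;
  the constant compares the two.
\<close>

lemma word_length_numeric_value:
  assumes "group G" "finite_generating_set G X" "set xs \<subseteq> carrier G"
  shows "\<exists>C. \<forall>w. word_length G X (numeric_value G xs w) \<le> C * length w"
proof -
  interpret group G by fact
  define C where "C = (\<Sum>l<2 * length xs. word_length G X (letter_value G xs l))"
  have C: "word_length G X (letter_value G xs l) \<le> C" for l
  proof (cases "l < 2 * length xs")
    case True
    then show ?thesis unfolding C_def by (intro member_le_sum) auto
  next
    case False
    then show ?thesis by (simp add: letter_value_def word_length_one)
  qed
  have "word_length G X (numeric_value G xs w) \<le> C * length w" for w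
  proof (induction w)
    case (Cons l w)
    then show ?case
      using word_length_mult[OF assms(2) letter_value_closed[OF assms(3)] numeric_value_closed[OF assms(3)], of l w]
        C[of l] by simp
  qed (simp add: word_length_one)
  then show ?thesis by blast
qed

section \<open>Searching Folner sets in a quotient\<close>

text \<open>
  Without repetitions of values, the cardinality of a set of values is the length of a list and thus
  computable.
\<close>

definition representatives :: "('w \<Rightarrow> 'k) \<Rightarrow> 'w list \<Rightarrow> 'w list" where
  "representatives \<kappa> ws =
     foldr (\<lambda>w us. if list_all (\<lambda>u. \<kappa> u \<noteq> \<kappa> w) us then w # us else us) ws []"

lemma representatives_image: "\<kappa> ` set (representatives \<kappa> ws) = \<kappa> ` set ws"
proof (induction ws)
  case (Cons w ws)
  show ?case
  proof (cases "list_all (\<lambda>u. \<kappa> u \<noteq> \<kappa> w) (representatives \<kappa> ws)")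
    case True
    then have "representatives \<kappa> (w # ws) = w # representatives \<kappa> ws"
      by (simp add: representatives_def)
    then show ?thesis by (simp add: Cons.IH)
  next
    case False
    then have "representatives \<kappa> (w # ws) = representatives \<kappa> ws"
      by (simp add: representatives_def)
    moreover from False have "\<kappa> w \<in> \<kappa> ` set (representatives \<kappa> ws)"
      by (auto simp: list_all_iff) (metis imageI)
    ultimately show ?thesis by (simp add: Cons.IH insert_absorb)
  qed
qed (simp add: representatives_def)

lemma distinct_representatives: "distinct (map \<kappa> (representatives \<kappa> ws))"
  by (induction ws) (auto simp: representatives_def list_all_iff)

lemma computable_representatives:
  fixes \<kappa> :: "'w::coded \<Rightarrow> 'k"
  assumes eq: "computable (\<lambda>q. \<kappa> (fst q) = \<kappa> (snd q))" and "computable ws"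
  shows "computable (\<lambda>p. representatives \<kappa> (ws p))"
proof -
  have *: "computable (\<lambda>p. \<kappa> (f p) = \<kappa> (g p))" if "computable f" "computable g" for f g :: "'p::coded \<Rightarrow> 'w"
    using computable_comp[OF eq computable_Pair[OF that]] by simp
  show ?thesis
    unfolding representatives_def by (intro computable_foldr computable_intros * assms(2))
qed

text \<open>
  When \<open>\<kappa>\<close> evaluates words in a group, these represent the elements that lie outside the translate by \<open>l\<close>
  of the set of values.
\<close>

definition escaping :: "(nat list \<Rightarrow> 'k) \<Rightarrow> nat list list \<Rightarrow> nat \<Rightarrow> nat list list" where
  "escaping \<kappa> us l = filter (\<lambda>u. list_all (\<lambda>v. \<kappa> u \<noteq> \<kappa> (l # v)) us) us"

definition folner_words :: "(nat list \<Rightarrow> 'k) \<Rightarrow> nat \<Rightarrow> nat \<Rightarrow> nat list list \<Rightarrow> bool" where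
  "folner_words \<kappa> k p us \<longleftrightarrow> 0 < length us \<and>
     list_all (\<lambda>l. p * length (escaping \<kappa> us l) \<le> length us) [0..<k]"

text \<open>
  Every number codes a list of lists of numbers, so that minimisation over the numbers visits all candidates.
\<close>

lemma computable_search:
  fixes P :: "nat \<Rightarrow> nat list list \<Rightarrow> bool"
  assumes "computable (\<lambda>q. P (fst q) (snd q))" "\<And>p. \<exists>ws. P p ws"
  shows "\<exists>S. computable S \<and> (\<forall>p. P p (S p))"
proof -
  define dec :: "nat \<Rightarrow> nat list list" where "dec = (\<lambda>y. map list_decode (list_decode y))"
  have dec: "computable dec"
    unfolding dec_def by (rule computable_recode[OF computable_id]) (simp add: comp_def)
  have ex: "\<exists>y. P p (dec y)" for p
  proof -
    obtain ws where "P p ws" using assms(2) by blast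
    then show ?thesis by (intro exI[of _ "encode ws"]) (simp add: dec_def comp_def)
  qed
  have "computable (\<lambda>q. P (fst q) (dec (snd q)))"
    using computable_comp[OF assms(1), of "\<lambda>q. (fst q, dec (snd q))"]
    by (simp add: computable_intros computable_comp[OF dec])
  then have "computable (\<lambda>p. LEAST y. P p (dec y))"
    using ex by (rule computable_Least)
  then show ?thesis
    using LeastI_ex[OF ex] by (intro exI[of _ "\<lambda>p. dec (LEAST y. P p (dec y))"]) (simp add: computable_comp[OF dec])
qed

lemma computable_escaping:
  fixes \<kappa> :: "nat list \<Rightarrow> 'k"
  assumes eq: "computable (\<lambda>q. \<kappa> (fst q) = \<kappa> (snd q))" and "computable us" "computable l"
  shows "computable (\<lambda>p. escaping \<kappa> (us p) (l p))"
proof -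
  have *: "computable (\<lambda>p. \<kappa> (f p) = \<kappa> (g p))" if "computable f" "computable g"
    for f g :: "'p::coded \<Rightarrow> nat list"
    using computable_comp[OF eq computable_Pair[OF that]] by simp
  have us: "computable (\<lambda>p. us (f p))" and l: "computable (\<lambda>p. l (f p))"
    if "computable f" for f :: "'p::coded \<Rightarrow> 'a"
    using computable_comp[OF assms(2) that] computable_comp[OF assms(3) that] .
  show ?thesis
    unfolding escaping_def by (intro computable_intros * us l assms(2))
qed

lemma computable_folner_words:
  fixes \<kappa> :: "nat list \<Rightarrow> 'k"
  assumes eq: "computable (\<lambda>q. \<kappa> (fst q) = \<kappa> (snd q))"
  shows "computable (\<lambda>q. folner_words \<kappa> k (fst q) (representatives \<kappa> (snd q)))"
  unfolding folner_words_def
  by (intro computable_intros computable_escaping[OF eq] computable_representatives[OF eq])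

lemma length_escaping:
  assumes "distinct (map \<kappa> us)" "group K" "\<And>v. v \<in> set us \<Longrightarrow> \<kappa> (l # v) = x \<otimes>\<^bsub>K\<^esub> \<kappa> v"
  shows "length (escaping \<kappa> us l) = displacement K (\<kappa> ` set us) x"
proof -
  interpret group K by fact
  have "\<kappa> ` set us - (x <#\<^bsub>K\<^esub> (\<kappa> ` set us)) = \<kappa> ` set (escaping \<kappa> us l)"
    using assms(3) by (force simp: l_coset_conv_image escaping_def list_all_iff)
  moreover have "set (escaping \<kappa> us l) \<subseteq> set us" "distinct (escaping \<kappa> us l)"
    using assms(1) by (auto simp: escaping_def distinct_map)
  ultimately show ?thesis
    unfolding displacement_def using assms(1)
    by (metis card_image distinct_card distinct_map inj_on_subset)
qed

text \<open>
  A Folner set of the quotient, given by representatives in \<open>G\<close>. Candidates are lists of words over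
  generators of \<open>G\<close>, and the word problem of \<open>K\<close> decides whether a candidate is good enough.
  The words found serve as coset representatives, so that no section of \<open>\<pi>\<close> needs to be computed.
  Amenability is used only to see that the search ends.
\<close>

lemma computable_quotient_folner:
  assumes "group G" "group K" "\<pi> \<in> epi G K" "finite_generating_set G (set xs)"
    and "finite_generating_set K Z" "solvable_word_problem K Z"
    and "finite_generating_set K Z'" "amenable K Z'"
  defines "\<kappa> \<equiv> \<lambda>w. \<pi> (numeric_value G xs w)"
  shows "\<exists>S :: nat \<Rightarrow> nat list list. computable S \<and> (\<forall>p. S p \<noteq> [] \<and> distinct (map \<kappa> (S p)) \<and>
    (\<forall>x\<in>set xs. p * displacement K (\<kappa> ` set (S p)) (\<pi> x) \<le> card (\<kappa> ` set (S p))))"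
proof -
  have hom: "\<pi> \<in> hom G K" using assms(3) by (simp add: epi_def)
  interpret \<pi>: group_hom G K \<pi> using assms hom by (simp add: group_hom_def group_hom_axioms_def)
  have xs: "set xs \<subseteq> carrier G" using assms(4) by (simp add: finite_generating_set_def)
  note closed = \<pi>.G.letter_value_closed[OF xs] \<pi>.G.numeric_value_closed[OF xs]
  have eq: "computable (\<lambda>q. \<kappa> (fst q) = \<kappa> (snd q))"
    unfolding \<kappa>_def by (rule computable_quotient_equality[OF assms(1,2) hom assms(4-6)])
  define k where "k = 2 * length xs"
  have \<kappa>_Cons: "\<kappa> (l # v) = \<pi> (letter_value G xs l) \<otimes>\<^bsub>K\<^esub> \<kappa> v" for l v
    by (simp add: \<kappa>_def closed)
  have esc: "length (escaping \<kappa> us l) = displacement K (\<kappa> ` set us) (\<pi> (letter_value G xs l))"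
    if "distinct (map \<kappa> us)" for us l
    using that by (intro length_escaping \<kappa>_Cons \<pi>.H.is_group)
  have ex: "\<exists>ws. folner_words \<kappa> k p (representatives \<kappa> ws)" for p
  proof -
    \<comment> \<open>images of the generators and of their inverses, so that the letters form a range of numbers\<close>
    define T where "T = (\<lambda>l. \<pi> (letter_value G xs l)) ` {..<k}"
    have "finite T" "T \<subseteq> carrier K" using closed by (auto simp: T_def)
    then obtain D where D: "D > 0" "\<And>m F t. m > 0 \<Longrightarrow> folner_set K Z' m F \<Longrightarrow> t \<in> T \<Longrightarrow>
        m * displacement K F t \<le> D * card F"
      using \<pi>.H.displacement_change_generators[OF assms(7)] by meson
    \<comment> \<open>the factor \<open>D\<close> is lost in the change of generators; the successor keeps \<open>m\<close> positive for \<open>p = 0\<close>\<close>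
    define m where "m = D * Suc p"
    have m: "m > 0" using D(1) by (simp add: m_def)
    then obtain F where F: "folner_set K Z' m F" using assms(8) by (auto simp: amenable_def)
    then have F': "F \<noteq> {}" "finite F" "F \<subseteq> carrier K" using m by (auto simp: folner_set_iff)
    have "F \<subseteq> range \<kappa>"
    proof
      fix y assume "y \<in> F"
      then obtain g where "g \<in> carrier G" "y = \<pi> g" using F'(3) assms(3) by (auto simp: epi_def)
      then show "y \<in> range \<kappa>" using \<pi>.G.numeric_value_surj[OF assms(4)] by (auto simp: \<kappa>_def)
    qed
    then obtain W where "finite W" "F = \<kappa> ` W" using F'(2) by (metis finite_subset_image)
    then obtain ws where ws: "\<kappa> ` set ws = F" by (metis finite_list)
    define us where "us = representatives \<kappa> ws"
    have us: "distinct (map \<kappa> us)" "\<kappa> ` set us = F"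
      by (simp_all add: us_def distinct_representatives representatives_image ws)
    then have len: "length us = card F" by (metis distinct_card length_map set_map)
    have "p * length (escaping \<kappa> us l) \<le> length us" if "l < k" for l
    proof -
      define d where "d = displacement K F (\<pi> (letter_value G xs l))"
      have "\<pi> (letter_value G xs l) \<in> T" using that by (simp add: T_def)
      from D(2)[OF m F this] have "D * (Suc p * d) \<le> D * card F"
        by (simp only: m_def d_def mult.assoc)
      then have "p * d \<le> card F" using D(1) by simp
      then show ?thesis by (simp add: esc[OF us(1)] us(2) len d_def)
    qed
    moreover have "0 < length us" using len F' by (simp add: card_gt_0_iff)
    ultimately show ?thesis
      by (intro exI[of _ ws]) (auto simp: folner_words_def us_def list_all_iff)
  qed
  obtain S where S: "computable S" "\<And>p. folner_words \<kappa> k p (representatives \<kappa> (S p))"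
    using computable_search[OF computable_folner_words[OF eq, of k] ex] by blast
  define R where "R = (\<lambda>p. representatives \<kappa> (S p))"
  have R: "computable R" unfolding R_def by (intro computable_representatives eq S(1))
  have fw: "folner_words \<kappa> k p (R p)" for p using S(2) by (simp add: R_def)
  have d: "distinct (map \<kappa> (R p))" for p by (simp add: R_def distinct_representatives)
  have "p * displacement K (\<kappa> ` set (R p)) (\<pi> x) \<le> card (\<kappa> ` set (R p))" if "x \<in> set xs" for p x
  proof -
    from that obtain i where i: "i < length xs" "xs ! i = x" by (auto simp: in_set_conv_nth)
    then have l: "letter_value G xs (2 * i + 1) = x" "2 * i + 1 < k"
      by (auto simp: letter_value_def k_def)
    have "p * length (escaping \<kappa> (R p) (2 * i + 1)) \<le> length (R p)"
      using fw[of p] l(2) by (auto simp: folner_words_def list_all_iff)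
    moreover have "card (\<kappa> ` set (R p)) = length (R p)" using d by (metis distinct_card length_map set_map)
    ultimately show ?thesis using esc[OF d, of p "2 * i + 1"] unfolding l(1) by simp
  qed
  moreover have "R p \<noteq> []" for p using fw[of p] by (auto simp: folner_words_def)
  ultimately show ?thesis using R d by blast
qed

section \<open>Folner sets of the extension\<close>

theorem corollary4p2:
  fixes N :: "('n, 'a) monoid_scheme" and \<Gamma> :: "('g, 'b) monoid_scheme"
    and K :: "('k, 'c) monoid_scheme"
    and \<iota> :: "'n \<Rightarrow> 'g" and \<pi> :: "'g \<Rightarrow> 'k"
    and X X' :: "'g set" and Y Y' :: "'n set" and Z Z' :: "'k set"
  assumes "short_exact N \<Gamma> K \<iota> \<pi>"
    and "finite_generating_set N Y" "finite_generating_set N Y'"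
    and "finite_generating_set \<Gamma> X" "finite_generating_set \<Gamma> X'"
    and "finite_generating_set K Z" "finite_generating_set K Z'"
    and "computable_folner_sets N Y'"
    and "subrecursive (distortion N Y \<Gamma> X \<iota>)"
    and "amenable K Z'"
    and "solvable_word_problem K Z"
  shows "computable_folner_sets \<Gamma> X'"
proof -
  have grp: "group N" "group \<Gamma>" "group K" and mon: "\<iota> \<in> mon N \<Gamma>" and epi: "\<pi> \<in> epi \<Gamma> K"
    using assms(1) by (auto simp: short_exact_def)
  have \<iota>: "\<iota> \<in> hom N \<Gamma>" using mon by (simp add: mon_def)
  interpret N: group N by fact
  interpret G: group \<Gamma> by fact
  interpret \<iota>: group_hom N \<Gamma> \<iota> using \<iota> by unfold_locales
  interpret \<pi>: group_hom \<Gamma> K \<pi> using grp epi by (simp add: group_hom_def group_hom_axioms_def epi_def)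
  obtain xs where xs: "distinct xs" "set xs = X'"
    using assms(5) finite_distinct_list unfolding finite_generating_set_def by blast
  then have X': "set xs \<subseteq> carrier \<Gamma>" and gen: "finite_generating_set \<Gamma> (set xs)"
    using assms(5) by (auto simp: finite_generating_set_def)
  define \<nu> where "\<nu> = numeric_value \<Gamma> xs"
  have \<nu>: "\<nu> w \<in> carrier \<Gamma>" for w using G.numeric_value_closed[OF X'] by (simp add: \<nu>_def)
  define \<kappa> where "\<kappa> = (\<lambda>w. \<pi> (\<nu> w))"
  obtain S where S: "computable S" "\<And>p. S p \<noteq> []" "\<And>p. distinct (map \<kappa> (S p))"
    "\<And>p x. x \<in> set xs \<Longrightarrow> p * displacement K (\<kappa> ` set (S p)) (\<pi> x) \<le> card (\<kappa> ` set (S p))"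
    using computable_quotient_folner[OF grp(2,3) epi gen assms(6,11,7,10)]
    unfolding \<kappa>_def \<nu>_def by blast
  obtain ys f where ys: "set ys = Y'" and f: "recursive_function f"
    "\<And>m. m > 0 \<Longrightarrow> \<exists>F. codes_subset ys (f m) F \<and> folner_set N Y' m (canonical_epi N ` F)"
    using assms(8) unfolding computable_folner_sets_def by blast
  have Y': "set ys \<subseteq> carrier N" using assms(3) ys by (simp add: finite_generating_set_def)
  define A where "A = (\<lambda>m. numeric_value N ys ` set (map list_decode (list_decode (f m))))"
  have A: "folner_set N Y' m (A m)" if "m > 0" for m
    using f(2)[OF that] N.codes_subset_value[OF _ Y'] by (auto simp: A_def)
  obtain T where T: "computable T" "\<And>w. \<nu> (T w) = \<iota> (numeric_value N ys w)"
    using numeric_value_translation[OF grp(1,2) \<iota> Y' gen] unfolding \<nu>_def by blast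
  obtain \<Delta> where \<Delta>: "recursive_function \<Delta>" "\<And>n. distortion N Y \<Gamma> X \<iota> n \<le> \<Delta> n"
    using assms(9) unfolding subrecursive_def by blast
  obtain D where D: "\<And>m F y. m > 0 \<Longrightarrow> folner_set N Y' m F \<Longrightarrow> y \<in> Y \<Longrightarrow>
      m * displacement N F y \<le> D * card F"
    using N.displacement_change_generators[OF assms(3), of Y] assms(2)
    unfolding finite_generating_set_def by blast
  obtain C where C: "\<And>w. word_length \<Gamma> X (\<nu> w) \<le> C * length w"
    using word_length_numeric_value[OF grp(2) assms(4) X'] unfolding \<nu>_def by blast
  \<comment> \<open>precision in the quotient: \<open>displacement_extension\<close> loses a factor 2\<close>
  define p where "p = (\<lambda>n. 2 * Suc n)"
  \<comment> \<open>bounds the length of all elements \<open>inv u \<otimes> x \<otimes> v\<close> with coset representatives \<open>u\<close>, \<open>v\<close>\<close>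
  define L where "L = (\<lambda>n. C * (2 * sum_list (map length (S (p n))) + 1))"
  \<comment> \<open>precision in \<open>N\<close>: elements of \<open>Y\<close>-length at most \<open>\<Delta> (L n)\<close> still have to be \<open>p n\<close>-good; \<open>Suc\<close> keeps it positive\<close>
  define m where "m = (\<lambda>n. p n * Suc (\<Delta> (L n) * D))"
  define out where "out = (\<lambda>n. concat (map (\<lambda>u. map (\<lambda>v. proper_letters xs (u @ T v))
      (map list_decode (list_decode (f (m n))))) (S (p n))))"
  have comp: "computable f" "computable \<Delta>"
    using f(1) \<Delta>(1) by (simp_all add: recursive_function_iff_computable)
  have decode: "computable (\<lambda>n. map list_decode (list_decode (g n)))" if "computable g"
    for g :: "nat \<Rightarrow> nat"
    by (rule computable_recode[OF that]) (simp add: comp_def)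
  have "computable m"
    unfolding m_def L_def p_def
    by (intro computable_intros computable_comp[OF S(1)] computable_comp[OF comp(2)])
  then have dec: "computable (\<lambda>n. map list_decode (list_decode (f (m n))))"
    by (intro decode computable_comp[OF comp(1)])
  have "computable out"
    unfolding out_def p_def
    by (intro computable_intros computable_comp[OF S(1)] computable_comp[OF T(1)] computable_comp[OF dec])
  then have rec: "recursive_function (\<lambda>n. encode (out n))"
    by (simp only: recursive_function_iff_computable computable_encode)
  have out_value: "\<nu> ` set (out n) = (\<lambda>(u, h). u \<otimes>\<^bsub>\<Gamma>\<^esub> \<iota> h) ` (\<nu> ` set (S (p n)) \<times> A (m n))" (is "_ = ?F n") for n
  proof -
    have "\<nu> (proper_letters xs (u @ T v)) = \<nu> u \<otimes>\<^bsub>\<Gamma>\<^esub> \<iota> (numeric_value N ys v)" for u v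
      using T(2)[of v] G.numeric_value_proper_letters[OF X'] G.numeric_value_append[OF X']
      by (simp add: \<nu>_def)
    then have "\<nu> ` set (out n) = (\<Union>u\<in>set (S (p n)). (\<lambda>h. \<nu> u \<otimes>\<^bsub>\<Gamma>\<^esub> \<iota> h) ` A (m n))"
      unfolding out_def A_def by (simp add: image_UN image_image)
    then show ?thesis by auto
  qed
  have folner: "folner_set \<Gamma> X' n (?F n)" if "n > 0" for n
  proof -
    define U where "U = \<nu> ` set (S (p n))"
    have "m n > 0" by (simp add: m_def p_def)
    note An = A[OF this]
    have An': "A (m n) \<noteq> {}" "finite (A (m n))" "A (m n) \<subseteq> carrier N"
      using An \<open>m n > 0\<close> by (auto simp: folner_set_iff)
    have U: "U \<noteq> {}" "finite U" "U \<subseteq> carrier \<Gamma>" using S(2) \<nu> by (auto simp: U_def)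
    have \<pi>U: "\<pi> ` U = \<kappa> ` set (S (p n))" by (auto simp: U_def \<kappa>_def)
    have inj: "inj_on \<pi> U"
      using S(3)[of "p n"] by (auto simp: U_def \<kappa>_def distinct_map intro!: inj_onI dest: inj_onD)
    have len: "word_length \<Gamma> X u \<le> C * sum_list (map length (S (p n)))" if "u \<in> U" for u
    proof -
      from that obtain w where w: "w \<in> set (S (p n))" "u = \<nu> w" by (auto simp: U_def)
      then have "length w \<le> sum_list (map length (S (p n)))" by (intro member_le_sum_list) auto
      then show ?thesis using C[of w] w(2) by (meson le_trans mult_le_mono2)
    qed
    \<comment> \<open>the distortion enters here: \<open>h\<close> is short in \<open>\<Gamma>\<close>, hence not too long in \<open>N\<close>\<close>
    have pA: "p n * displacement N (A (m n)) h \<le> card (A (m n))"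
      if "x \<in> X'" "u \<in> U" "v \<in> U" "h \<in> carrier N" "\<iota> h = inv\<^bsub>\<Gamma>\<^esub> u \<otimes>\<^bsub>\<Gamma>\<^esub> x \<otimes>\<^bsub>\<Gamma>\<^esub> v" for x u v h
    proof -
      note h = that(4)
      have c: "u \<in> carrier \<Gamma>" "v \<in> carrier \<Gamma>" "x \<in> carrier \<Gamma>" using that U X' xs by auto
      from that(1) obtain i where i: "i < length xs" "xs ! i = x"
        unfolding xs(2)[symmetric] by (auto simp: in_set_conv_nth)
      have "\<nu> [2 * i + 1] = x" using i c by (simp add: \<nu>_def letter_value_def)
      then have "word_length \<Gamma> X x \<le> C" using C[of "[2 * i + 1]"] by simp
      moreover have "word_length \<Gamma> X (\<iota> h) \<le> word_length \<Gamma> X u + word_length \<Gamma> X x + word_length \<Gamma> X v"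
        using G.word_length_mult[OF assms(4), of "inv\<^bsub>\<Gamma>\<^esub> u \<otimes>\<^bsub>\<Gamma>\<^esub> x" v]
          G.word_length_mult[OF assms(4), of "inv\<^bsub>\<Gamma>\<^esub> u" x] G.word_length_inv[OF assms(4) c(1)] c that(5)
        by simp
      ultimately have "word_length \<Gamma> X (\<iota> h) \<le> L n"
        using len[OF that(2)] len[OF that(3)] by (simp add: L_def algebra_simps)
      then have l: "word_length N Y h \<le> \<Delta> (L n)"
        using word_length_le_distortion[OF grp(2) assms(4) mon that(4)] \<Delta>(2) by (meson le_trans)
      obtain w where w: "w \<in> words Y" "length w = word_length N Y h" "word_value N w = h"
        using N.word_length_attained[OF assms(2) h] .
      have "m n * displacement N (A (m n)) h \<le> length w * (D * card (A (m n)))"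
        unfolding w(3)[symmetric]
        by (rule N.displacement_word[OF An'(2,3) _ D[OF \<open>m n > 0\<close> An] w(1)])
           (use assms(2) in \<open>auto simp: finite_generating_set_def\<close>)
      also have "\<dots> \<le> \<Delta> (L n) * (D * card (A (m n)))"
        using l w(2) by (intro mult_le_mono1) simp
      also have "\<dots> \<le> Suc (\<Delta> (L n) * D) * card (A (m n))" by simp
      finally have "Suc (\<Delta> (L n) * D) * (p n * displacement N (A (m n)) h) \<le> Suc (\<Delta> (L n) * D) * card (A (m n))"
        by (simp only: m_def mult.assoc mult.left_commute)
      then show ?thesis by (simp only: mult_le_cancel1)
    qed
    have "n * displacement \<Gamma> (?F n) x \<le> card (?F n)" if "x \<in> X'" for x
    proof -
      have "p n * displacement \<Gamma> (?F n) x \<le> 2 * card (?F n)"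
        unfolding U_def[symmetric]
      proof (rule displacement_extension[OF assms(1) _ U(2,3) inj An'(2,3)])
        show "x \<in> carrier \<Gamma>" using that xs X' by auto
        show "p n * displacement K (\<pi> ` U) (\<pi> x) \<le> card (\<pi> ` U)"
          unfolding \<pi>U using S(4) that xs by simp
      qed (use pA that in blast)
      then show ?thesis by (simp add: p_def)
    qed
    moreover have "?F n \<noteq> {}" "finite (?F n)" "?F n \<subseteq> carrier \<Gamma>"
      using U An' by (auto simp: U_def[symmetric] intro!: G.m_closed)
    ultimately show ?thesis using that by (simp add: folner_set_iff)
  qed
  have "\<exists>F. codes_subset xs (encode (out n)) F \<and> canonical_epi \<Gamma> ` F = \<nu> ` set (out n)" for n
    unfolding \<nu>_def
    by (rule G.codes_subset_proper_letters[OF _ X']) (auto simp: out_def dest: proper_letters_less)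
  then show ?thesis
    unfolding computable_folner_sets_def using xs rec folner out_value by metis
qed

end
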